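(* Let $n\ge3$ and $d\ge2$. The order of $\mathbb{T}_n^d$ equals $|\mathbb{R}_d|\cdot|\mathbb{F}_n|$.
   Context: Let $[n]=\{0,\dots,n-1\}$; the cube $n^d$ is $[n]^d$. A set of $n$ distinct points is a line if it can be ordered $(q^1,\dots,q^n)$ such that in each coordinate the sequence of values is strictly increasing, strictly decreasing or constant, with at least one coordinate non-constant. $\mathbb{T}_n^d$ is the group of permutations of $[n]^d$ mapping lines onto lines. $\mathbb{R}_d$ is the group generated by the maps $R_{ij}$ ($i\ne j$), where $R_{ij}([x_1,\dots,x_d])$ has $i$-th coordinate $n-x_j-1$, $j$-th coordinate $x_i$, and other coordinates unchanged. $\mathbb{F}_n$ is the group of maps $F_\pi([x_1,\dots,x_d])=[\pi(x_1),\dots,\pi(x_d)]$ for permutations $\pi$ of $[n]$ with $\pi(n-p-1)=n-\pi(p)-1$ for all $p$. *)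

theory Defs
  imports "HOL-Algebra.Bij" "HOL-Algebra.Generated_Groups" "HOL-Combinatorics.Permutations"
begin

text \<open>A point \<open>[x\<^sub>1, \<dots>, x\<^sub>d]\<close> is a function on the index set \<open>{1..d}\<close>, extensional outside of it,
  so that distinct functions are distinct points.\<close>

definition cube :: "nat \<Rightarrow> nat \<Rightarrow> (nat \<Rightarrow> nat) set" where
  "cube n d = {1..d} \<rightarrow>\<^sub>E {..<n}"

definition is_line :: "nat \<Rightarrow> nat \<Rightarrow> (nat \<Rightarrow> nat) set \<Rightarrow> bool" where
  "is_line n d L \<longleftrightarrow> L \<subseteq> cube n d \<and>
     (\<exists>q. bij_betw q {1..n} L \<and>
        (\<forall>i\<in>{1..d}. strict_mono_on {1..n} (\<lambda>k. q k i) \<or>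
                    strict_antimono_on {1..n} (\<lambda>k. q k i) \<or>
                    (\<exists>c. \<forall>k\<in>{1..n}. q k i = c)) \<and>
        (\<exists>i\<in>{1..d}. \<not> (\<exists>c. \<forall>k\<in>{1..n}. q k i = c)))"

definition line_group :: "nat \<Rightarrow> nat \<Rightarrow> ((nat \<Rightarrow> nat) \<Rightarrow> nat \<Rightarrow> nat) monoid" where
  "line_group n d = BijGroup (cube n d)
     \<lparr>carrier := {f \<in> Bij (cube n d). \<forall>L. is_line n d L \<longrightarrow> is_line n d (f ` L)}\<rparr>"

definition rot :: "nat \<Rightarrow> nat \<Rightarrow> nat \<Rightarrow> nat \<Rightarrow> (nat \<Rightarrow> nat) \<Rightarrow> nat \<Rightarrow> nat" where
  "rot n d i j = (\<lambda>x\<in>cube n d. x(i := n - x j - 1, j := x i))"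

definition rot_group :: "nat \<Rightarrow> nat \<Rightarrow> ((nat \<Rightarrow> nat) \<Rightarrow> nat \<Rightarrow> nat) monoid" where
  "rot_group n d = BijGroup (cube n d)
     \<lparr>carrier := generate (BijGroup (cube n d))
        {rot n d i j | i j. i \<in> {1..d} \<and> j \<in> {1..d} \<and> i \<noteq> j}\<rparr>"

definition coord_map :: "nat \<Rightarrow> nat \<Rightarrow> (nat \<Rightarrow> nat) \<Rightarrow> (nat \<Rightarrow> nat) \<Rightarrow> nat \<Rightarrow> nat" where
  "coord_map n d \<pi> = (\<lambda>x\<in>cube n d. \<lambda>i\<in>{1..d}. \<pi> (x i))"

definition sym_perms :: "nat \<Rightarrow> (nat \<Rightarrow> nat) set" where
  "sym_perms n = {\<pi>. \<pi> permutes {..<n} \<and> (\<forall>p<n. \<pi> (n - p - 1) = n - \<pi> p - 1)}"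

definition coord_group :: "nat \<Rightarrow> nat \<Rightarrow> ((nat \<Rightarrow> nat) \<Rightarrow> nat \<Rightarrow> nat) monoid" where
  "coord_group n d = BijGroup (cube n d) \<lparr>carrier := coord_map n d ` sym_perms n\<rparr>"


subsection \<open>These structures are groups\<close>

lemma finite_cube: "finite (cube n d)"
  by (simp add: cube_def finite_PiE)

lemma group_line_group: "group (line_group n d)"
proof -
  let ?S = "cube n d"
  let ?T = "{f \<in> Bij ?S. \<forall>L. is_line n d L \<longrightarrow> is_line n d (f ` L)}"
  have sub: "L \<subseteq> ?S" if "is_line n d L" for L
    using that by (simp add: is_line_def)
  have comp_im: "compose ?S f g ` L = f ` g ` L" if "L \<subseteq> ?S" for f g L
    using that by (auto simp: compose_def image_iff subset_iff)
  have "subgroup ?T (BijGroup ?S)"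
  proof (rule subgroup.intro)
    show "?T \<subseteq> carrier (BijGroup ?S)" by (auto simp: BijGroup_def)
  next
    fix f g assume "f \<in> ?T" "g \<in> ?T"
    then show "f \<otimes>\<^bsub>BijGroup ?S\<^esub> g \<in> ?T"
      by (auto simp: BijGroup_def compose_Bij comp_im sub)
  next
    have "(\<lambda>x\<in>?S. x) ` L = L" if "L \<subseteq> ?S" for L
      using that by (auto simp: image_iff subset_iff)
    then show "\<one>\<^bsub>BijGroup ?S\<^esub> \<in> ?T"
      by (auto simp: BijGroup_def id_Bij sub)
  next
    fix f assume f: "f \<in> ?T"
    then have bij: "bij_betw f ?S ?S" by (simp add: Bij_def)
    let ?L = "{L. is_line n d L}"
    have fin: "finite ?L"
      by (rule finite_subset[of _ "Pow ?S"]) (auto simp: finite_cube dest: sub)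
    have inj: "inj_on (image f) ?L"
      using bij sub by (intro inj_onI) (metis bij_betw_def inj_on_image_eq_iff mem_Collect_eq)
    have "image f ` ?L = ?L"
      using f by (intro endo_inj_surj[OF fin _ inj]) auto
    then have ex: "\<exists>K. is_line n d K \<and> L = f ` K" if "is_line n d L" for L
      using that by (metis (mono_tags, lifting) imageE mem_Collect_eq)
    have inv_im: "restrict (inv_into ?S f) ?S ` f ` K = K" if "K \<subseteq> ?S" for K
    proof -
      have "restrict (inv_into ?S f) ?S (f x) = x" if "x \<in> K" for x
        using that \<open>K \<subseteq> ?S\<close> bij by (auto simp: bij_betw_def)
      then show ?thesis unfolding image_image by (simp del: restrict_apply cong: image_cong)
    qed
    have "is_line n d (restrict (inv_into ?S f) ?S ` L)" if "is_line n d L" for L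
      using ex[OF that] inv_im sub by metis
    then show "inv\<^bsub>BijGroup ?S\<^esub> f \<in> ?T"
      using f by (simp add: inv_BijGroup restrict_inv_into_Bij)
  qed
  then show ?thesis
    unfolding line_group_def by (rule group.subgroup_imp_group[OF group_BijGroup])
qed

lemma rot_in_Bij:
  assumes "i \<in> {1..d}" "j \<in> {1..d}" "i \<noteq> j"
  shows "rot n d i j \<in> Bij (cube n d)"
proof -
  have maps: "rot n d i j ` cube n d \<subseteq> cube n d"
  proof (rule image_subsetI)
    fix x assume x: "x \<in> cube n d"
    then have "x j < n" "x i < n" using assms by (auto simp: cube_def)
    with x show "rot n d i j x \<in> cube n d"
      using assms by (auto simp: rot_def cube_def PiE_iff extensional_def)
  qed
  have inj: "inj_on (rot n d i j) (cube n d)"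
  proof (rule inj_onI)
    fix x y assume x: "x \<in> cube n d" and y: "y \<in> cube n d"
      and eq: "rot n d i j x = rot n d i j y"
    have bnd: "x j < n" "y j < n" using x y assms by (auto simp: cube_def)
    have E: "(x(i := n - x j - 1, j := x i)) k = (y(i := n - y j - 1, j := y i)) k" for k
      using eq x y by (simp add: rot_def fun_eq_iff)
    have "x i = y i" using E[of j] by simp
    moreover have "x j = y j" using E[of i] assms(3) bnd by simp
    moreover have "x k = y k" if "k \<noteq> i" "k \<noteq> j" for k using E[of k] that by simp
    ultimately show "x = y" by (metis ext)
  qed
  have "rot n d i j ` cube n d = cube n d"
    by (rule endo_inj_surj[OF finite_cube maps inj])
  with inj show ?thesis
    by (simp add: Bij_def bij_betw_def) (simp add: rot_def)
qed

lemma group_rot_group: "group (rot_group n d)"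
proof -
  have "{rot n d i j | i j. i \<in> {1..d} \<and> j \<in> {1..d} \<and> i \<noteq> j} \<subseteq> carrier (BijGroup (cube n d))"
    using rot_in_Bij by (auto simp: BijGroup_def)
  from group.generate_is_subgroup[OF group_BijGroup this] show ?thesis
    unfolding rot_group_def by (rule group.subgroup_imp_group[OF group_BijGroup])
qed

lemma coord_map_id: "coord_map n d id = (\<lambda>x\<in>cube n d. x)"
proof
  fix x
  show "coord_map n d id x = (\<lambda>x\<in>cube n d. x) x"
    by (auto simp: coord_map_def cube_def)
qed

lemma coord_map_in_cube:
  "\<pi> permutes {..<n} \<Longrightarrow> x \<in> cube n d \<Longrightarrow> coord_map n d \<pi> x \<in> cube n d"
  by (auto simp: coord_map_def cube_def PiE_iff permutes_in_image[of \<pi> "{..<n}", unfolded lessThan_iff])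

lemma coord_map_comp:
  assumes "\<sigma> permutes {..<n}"
  shows "compose (cube n d) (coord_map n d \<pi>) (coord_map n d \<sigma>) = coord_map n d (\<pi> \<circ> \<sigma>)"
proof
  fix x
  show "compose (cube n d) (coord_map n d \<pi>) (coord_map n d \<sigma>) x = coord_map n d (\<pi> \<circ> \<sigma>) x"
    using coord_map_in_cube[OF assms, of x d]
    by (auto simp: compose_def coord_map_def fun_eq_iff)
qed

lemma coord_map_in_Bij:
  assumes p: "\<pi> permutes {..<n}"
  shows "coord_map n d \<pi> \<in> Bij (cube n d)"
proof -
  let ?S = "cube n d"
  have q: "inv_into UNIV \<pi> permutes {..<n}" using p by (rule permutes_inv)
  have a: "compose ?S (coord_map n d (inv_into UNIV \<pi>)) (coord_map n d \<pi>) = (\<lambda>x\<in>?S. x)"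
    using coord_map_comp[OF p] p by (simp add: permutes_inv_o coord_map_id)
  have b: "compose ?S (coord_map n d \<pi>) (coord_map n d (inv_into UNIV \<pi>)) = (\<lambda>x\<in>?S. x)"
    using coord_map_comp[OF q] p by (simp add: permutes_inv_o coord_map_id)
  have "bij_betw (coord_map n d \<pi>) ?S ?S"
  proof (rule bij_betw_byWitness[where f' = "coord_map n d (inv_into UNIV \<pi>)"])
    show "\<forall>x\<in>?S. coord_map n d (inv_into UNIV \<pi>) (coord_map n d \<pi> x) = x"
      using fun_cong[OF a] by (metis compose_eq restrict_apply')
    show "\<forall>x\<in>?S. coord_map n d \<pi> (coord_map n d (inv_into UNIV \<pi>) x) = x"
      using fun_cong[OF b] by (metis compose_eq restrict_apply')
  qed (use coord_map_in_cube p q in auto)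
  then show ?thesis by (simp add: Bij_def) (simp add: coord_map_def)
qed

lemma sym_perms_comp: "\<pi> \<in> sym_perms n \<Longrightarrow> \<sigma> \<in> sym_perms n \<Longrightarrow> \<pi> \<circ> \<sigma> \<in> sym_perms n"
  unfolding sym_perms_def
  by (auto intro: permutes_compose) (metis lessThan_iff permutes_in_image)

lemma sym_perms_inv:
  assumes "\<pi> \<in> sym_perms n"
  shows "inv_into UNIV \<pi> \<in> sym_perms n"
proof -
  from assms have p: "\<pi> permutes {..<n}"
    and s: "\<And>p. p < n \<Longrightarrow> \<pi> (n - p - 1) = n - \<pi> p - 1"
    by (auto simp: sym_perms_def)
  have "inv_into UNIV \<pi> (n - k - 1) = n - inv_into UNIV \<pi> k - 1" if "k < n" for k
  proof -
    have "inv_into UNIV \<pi> k < n"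
      using that permutes_in_image[OF permutes_inv[OF p], of k] by simp
    from s[OF this] have "\<pi> (n - inv_into UNIV \<pi> k - 1) = n - k - 1"
      using permutes_inverses(1)[OF p] by simp
    then show ?thesis using permutes_inverses(2)[OF p] by metis
  qed
  then show ?thesis using permutes_inv[OF p] by (simp add: sym_perms_def)
qed

lemma group_coord_group: "group (coord_group n d)"
proof -
  let ?S = "cube n d" and ?F = "coord_map n d ` sym_perms n"
  have perm: "\<pi> permutes {..<n}" if "\<pi> \<in> sym_perms n" for \<pi>
    using that by (simp add: sym_perms_def)
  have mult: "coord_map n d \<pi> \<otimes>\<^bsub>BijGroup ?S\<^esub> coord_map n d \<sigma> = coord_map n d (\<pi> \<circ> \<sigma>)"
    if "\<pi> \<in> sym_perms n" "\<sigma> \<in> sym_perms n" for \<pi> \<sigma>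
    using that by (simp add: BijGroup_def coord_map_in_Bij coord_map_comp perm)
  have id: "id \<in> sym_perms n" by (simp add: sym_perms_def permutes_id)
  have one: "\<one>\<^bsub>BijGroup ?S\<^esub> = coord_map n d id"
    by (simp add: BijGroup_def coord_map_id)
  have carr: "coord_map n d \<pi> \<in> carrier (BijGroup ?S)" if "\<pi> \<in> sym_perms n" for \<pi>
    using coord_map_in_Bij[OF perm[OF that]] by (simp add: BijGroup_def)
  have "subgroup ?F (BijGroup ?S)"
  proof (rule subgroup.intro)
    show "?F \<subseteq> carrier (BijGroup ?S)" using carr by auto
    show "f \<otimes>\<^bsub>BijGroup ?S\<^esub> g \<in> ?F" if "f \<in> ?F" "g \<in> ?F" for f g
      using that mult sym_perms_comp by auto
    show "\<one>\<^bsub>BijGroup ?S\<^esub> \<in> ?F" using one id by auto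
  next
    fix f assume "f \<in> ?F"
    then obtain \<pi> where \<pi>: "\<pi> \<in> sym_perms n" "f = coord_map n d \<pi>" by auto
    have "coord_map n d (inv_into UNIV \<pi>) \<otimes>\<^bsub>BijGroup ?S\<^esub> f = \<one>\<^bsub>BijGroup ?S\<^esub>"
      using \<pi> mult[OF sym_perms_inv[OF \<pi>(1)] \<pi>(1)] perm[OF \<pi>(1)]
      by (simp add: one permutes_inv_o)
    then have "inv\<^bsub>BijGroup ?S\<^esub> f = coord_map n d (inv_into UNIV \<pi>)"
      using \<pi> carr sym_perms_inv by (intro group.inv_equality[OF group_BijGroup]) auto
    then show "inv\<^bsub>BijGroup ?S\<^esub> f \<in> ?F" using sym_perms_inv[OF \<pi>(1)] by auto
  qed
  then show ?thesis
    unfolding coord_group_def by (rule group.subgroup_imp_group[OF group_BijGroup])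
qed

end

theory Submission
  imports Defs
begin

text \<open>
  Write \<open>opp t = n - 1 - t\<close>. A line-preserving bijection preserves collinearity, hence the number of
  transversals of two lines \<open>L, M\<close> through a point \<open>P\<close>, that is of pairs of collinear points of
  \<open>L - {P}\<close> and \<open>M - {P}\<close>. This number avoids 0 and 2 for all \<open>L \<noteq> M\<close> through \<open>P\<close> exactly when all
  coordinates of \<open>P\<close> lie in one pair \<open>{a, opp a}\<close> with \<open>a \<noteq> opp a\<close>, i.e. when \<open>P\<close> is a noncentral
  point of a main diagonal; a central one is collinear with all of these. So main diagonals are
  mapped to main diagonals, and after composing with reflections of coordinates and a map \<open>F\<^sub>\<pi>\<close> the
  line \<open>x\<^sub>1 = \<dots> = x\<^sub>d\<close> is fixed pointwise. The induced map on the corners, seen as subsets of the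
  index set, is then an automorphism of the inclusion order, so a permutation of the coordinates
  makes all corners fixed. Finally, a map fixing the corners and the line \<open>x\<^sub>1 = \<dots> = x\<^sub>d\<close> is the
  identity, by induction on the number of pairs \<open>{a, opp a}\<close> met by the coordinates of a point.

  Consequently every element of the group is \<open>x \<mapsto> (\<plusminus> \<pi> (x (s i)))\<^sub>i\<close>, where \<open>\<plusminus>\<close> stands for the
  identity or \<open>opp\<close>, and uniquely so if the sign at coordinate 1 is positive. The rotations are the
  maps with \<open>\<pi> = id\<close> in which the number of reflected coordinates has the parity of \<open>s\<close>. So the
  three orders are \<open>d! 2\<^sup>d\<^sup>-\<^sup>1 |F\<^sub>n|\<close>, \<open>d! 2\<^sup>d\<^sup>-\<^sup>1\<close> and \<open>|F\<^sub>n|\<close>.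
\<close>

section \<open>Sets and monotone maps\<close>

lemma even_card_sym_diff:
  assumes "finite A" "finite B"
  shows "even (card (sym_diff A B)) \<longleftrightarrow> even (card A) = even (card B)"
proof -
  have "card (sym_diff A B) = card (A - B) + card (B - A)"
    using assms by (intro card_Un_disjoint) auto
  moreover have "card A = card (A - B) + card (A \<inter> B)" "card B = card (B - A) + card (A \<inter> B)"
    using assms card_Int_Diff[of A B] card_Int_Diff[of B A] by (auto simp: Int_commute)
  ultimately show ?thesis by presburger
qed

lemma card_subsets_of_parity:
  assumes "finite S" "S \<noteq> {}"
  shows "card {B. B \<subseteq> S \<and> even (card B) = b} = 2 ^ (card S - 1)"
proof -
  let ?E = "\<lambda>b. {B. B \<subseteq> S \<and> even (card B) = b}"
  have same: "card (?E True) = card (?E False)"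
    using card_subsupersets_even_odd[of S "{}"] assms by (simp add: psubset_eq)
  have "Pow S = ?E True \<union> ?E False" by auto
  then have "2 ^ card S = card (?E True \<union> ?E False)" using assms(1) by (metis card_Pow)
  also have "\<dots> = card (?E True) + card (?E False)"
    using assms(1) by (intro card_Un_disjoint) auto
  finally have "2 * 2 ^ (card S - 1) = 2 * card (?E b)"
    using same assms by (cases b) (auto simp flip: power_Suc simp: card_gt_0_iff)
  then show ?thesis by simp
qed

lemma strict_mono_on_lessThan_eq:
  fixes h :: "nat \<Rightarrow> nat"
  assumes "strict_mono_on {..<n} h" "\<And>k. k < n \<Longrightarrow> h k < n" "k < n"
  shows "h k = k"
proof -
  have increasing: "j \<le> g j" if "strict_mono_on {..<n} g" "j < n" for g :: "nat \<Rightarrow> nat" and j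
    using that(2)
  proof (induction j)
    case (Suc j)
    then show ?case using strict_mono_onD[OF that(1), of j "Suc j"] by simp
  qed simp
  have "strict_mono_on {..<n} (\<lambda>k. n - 1 - h (n - 1 - k))"
  proof (rule strict_mono_onI)
    fix r s assume "r \<in> {..<n}" "s \<in> {..<n}" "r < s"
    then have "h (n - 1 - s) < h (n - 1 - r)" "h (n - 1 - r) < n"
      using assms(2) by (auto intro: strict_mono_onD[OF assms(1)])
    then show "n - 1 - h (n - 1 - r) < n - 1 - h (n - 1 - s)" by simp
  qed
  from increasing[OF this, of "n - 1 - k"] have "n - 1 - k \<le> n - 1 - h k"
    using assms(3) by simp
  then show ?thesis using increasing[OF assms(1,3)] assms(2)[of k] assms(3) by simp
qed

lemma strict_antimono_on_lessThan_eq: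
  fixes h :: "nat \<Rightarrow> nat"
  assumes "strict_antimono_on {..<n} h" "\<And>k. k < n \<Longrightarrow> h k < n" "k < n"
  shows "h k = n - 1 - k"
proof -
  have "strict_mono_on {..<n} (\<lambda>k. n - 1 - h k)"
  proof (rule strict_mono_onI)
    fix r s assume "r \<in> {..<n}" "s \<in> {..<n}" "r < s"
    then show "n - 1 - h r < n - 1 - h s"
      using monotone_onD[OF assms(1), of r s] assms(2)[of r] by simp
  qed
  then have "n - 1 - h k = k"
    by (rule strict_mono_on_lessThan_eq) (use assms(3) in auto)
  then show ?thesis using assms(2)[OF assms(3)] by simp
qed

lemma permutes_vimage_subset: "s permutes T \<Longrightarrow> S \<subseteq> T \<Longrightarrow> s -` S \<subseteq> T"
  using permutes_vimage by blast

lemma card_vimage_permutes: "s permutes T \<Longrightarrow> card (s -` B) = card B"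
  by (rule card_vimage_inj) (simp_all add: permutes_inj permutes_surj)

abbreviation comparable :: "'a set \<Rightarrow> 'a set \<Rightarrow> bool" where
  "comparable S T \<equiv> S \<subseteq> T \<or> T \<subseteq> S"

lemma subset_iff_comparable_sym_diffs:
  assumes "A \<noteq> {}"
  shows "B \<subseteq> A \<longleftrightarrow>
    comparable (sym_diff {} B) (sym_diff {} A) \<and> comparable (sym_diff A {}) (sym_diff A B)"
  using assms by auto

lemma bij_betw_factor_permutes:
  assumes g: "bij_betw g S T" and h: "bij_betw h S T"
  obtains p where "p permutes S" "\<And>t. t \<in> S \<Longrightarrow> g t = h (p t)"
proof -
  let ?p = "restrict_id (inv_into S h \<circ> g) S"
  have "bij_betw (inv_into S h \<circ> g) S S"
    using g bij_betw_inv_into[OF h] by (rule bij_betw_trans)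
  then have "?p permutes S" by (rule permutes_restrict_id)
  moreover have "g t = h (?p t)" if "t \<in> S" for t
    using that bij_betw_inv_into_right[OF h bij_betwE[OF g, rule_format, OF that]]
    by (simp add: restrict_id_def)
  ultimately show thesis using that by blast
qed

context
  fixes S :: "'a set" and \<phi> :: "'a set \<Rightarrow> 'a set"
  assumes bij: "bij_betw \<phi> (Pow S) (Pow S)"
    and order_iff: "\<And>A B. A \<subseteq> S \<Longrightarrow> B \<subseteq> S \<Longrightarrow> \<phi> A \<subseteq> \<phi> B \<longleftrightarrow> A \<subseteq> B"
begin

lemma Pow_automorphism_preimage:
  assumes "B \<subseteq> S"
  shows "\<exists>A\<subseteq>S. \<phi> A = B"
  using assms bij by (metis Pow_iff bij_betw_iff_bijections)

lemma Pow_automorphism_empty_iff: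
  assumes "A \<subseteq> S"
  shows "\<phi> A = {} \<longleftrightarrow> A = {}"
proof -
  obtain E where "E \<subseteq> S" "\<phi> E = {}" using Pow_automorphism_preimage[of "{}"] by blast
  then show ?thesis using order_iff[of A E] order_iff[of E A] order_iff[of E "{}"] assms by auto
qed

lemma Pow_automorphism_singleton:
  assumes "i \<in> S"
  shows "\<exists>j\<in>S. \<phi> {i} = {j}"
proof -
  have "\<phi> {i} \<noteq> {}" "\<phi> {i} \<subseteq> S" using assms Pow_automorphism_empty_iff bij bij_betwE by fastforce+
  then obtain j where j: "j \<in> \<phi> {i}" "j \<in> S" by blast
  then obtain A where A: "A \<subseteq> S" "\<phi> A = {j}" using Pow_automorphism_preimage[of "{j}"] by blast
  then have "A \<subseteq> {i}" "A \<noteq> {}"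
    using order_iff[of A "{i}"] Pow_automorphism_empty_iff[of A] j assms by auto
  then have "A = {i}" by blast
  then show ?thesis using A j by auto
qed

lemma Pow_automorphism_induced_by_permutation:
  obtains \<sigma> where "\<sigma> permutes S" "\<And>A. A \<subseteq> S \<Longrightarrow> \<phi> A = \<sigma> ` A"
proof -
  obtain \<sigma> where \<sigma>: "\<sigma> i \<in> S" "\<phi> {i} = {\<sigma> i}" if "i \<in> S" for i
    using Pow_automorphism_singleton by metis
  have mem_iff: "\<sigma> i \<in> \<phi> A \<longleftrightarrow> i \<in> A" if "i \<in> S" "A \<subseteq> S" for i A
    using order_iff[of "{i}" A] \<sigma>[OF that(1)] that by auto
  have onto: "\<exists>i\<in>S. \<sigma> i = j" if j: "j \<in> S" for j
  proof -
    obtain A where A: "A \<subseteq> S" "\<phi> A = {j}" using j Pow_automorphism_preimage[of "{j}"] by auto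
    then obtain i where "i \<in> A" using Pow_automorphism_empty_iff[of A] by auto
    then show ?thesis using mem_iff[of i A] A by auto
  qed
  have "inj_on \<sigma> S"
  proof (rule inj_onI)
    fix i j assume "i \<in> S" "j \<in> S" "\<sigma> i = \<sigma> j"
    then show "i = j" using mem_iff[of i "{j}"] \<sigma>(2)[of j] by auto
  qed
  then have "restrict_id \<sigma> S permutes S"
    using onto \<sigma>(1) by (intro permutes_restrict_id) (auto simp: bij_betw_def)
  moreover have "\<phi> A = restrict_id \<sigma> S ` A" if A: "A \<subseteq> S" for A
  proof -
    have "\<phi> A \<subseteq> S" using A bij bij_betwE by blast
    then have "\<phi> A = {\<sigma> i | i. i \<in> S \<and> \<sigma> i \<in> \<phi> A}" using onto by blast
    also have "\<dots> = \<sigma> ` A" using mem_iff A by blast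
    also have "\<dots> = restrict_id \<sigma> S ` A" using A by (intro image_cong) auto
    finally show ?thesis .
  qed
  ultimately show thesis using that by blast
qed

end

section \<open>Lines\<close>

locale cube_lines =
  fixes n d :: nat
  assumes two_le_n: "2 \<le> n"
begin

abbreviation points :: "(nat \<Rightarrow> nat) set" where "points \<equiv> cube n d"
abbreviation coords :: "nat set" where "coords \<equiv> {1..d}"
abbreviation line :: "(nat \<Rightarrow> nat) set \<Rightarrow> bool" where "line \<equiv> is_line n d"

definition opp :: "nat \<Rightarrow> nat" where
  "opp t = n - 1 - t"

definition reflect :: "nat set \<Rightarrow> nat \<Rightarrow> nat \<Rightarrow> nat" where
  "reflect A i t = (if i \<in> A then opp t else t)"

text \<open>\<open>S\<close> is the set of varying coordinates of a line and \<open>A \<inter> S\<close> that of the decreasing ones.\<close>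

definition line_point :: "(nat \<Rightarrow> nat) \<Rightarrow> nat set \<Rightarrow> nat set \<Rightarrow> nat \<Rightarrow> nat \<Rightarrow> nat" where
  "line_point x S A t = (\<lambda>i. if i \<in> S then reflect A i t else x i)"

definition param_line :: "(nat \<Rightarrow> nat) \<Rightarrow> nat set \<Rightarrow> nat set \<Rightarrow> (nat \<Rightarrow> nat) set" where
  "param_line x S A = line_point x S A ` {..<n}"

lemma opp_less [simp]: "opp t < n"
  using two_le_n by (auto simp: opp_def)

lemma opp_opp [simp]: "t < n \<Longrightarrow> opp (opp t) = t"
  by (auto simp: opp_def)

lemma opp_eq_iff: "s < n \<Longrightarrow> t < n \<Longrightarrow> opp s = opp t \<longleftrightarrow> s = t"
  by (auto simp: opp_def)

lemma central_unique: "s < n \<Longrightarrow> t < n \<Longrightarrow> s = opp s \<Longrightarrow> t = opp t \<Longrightarrow> s = t"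
  by (auto simp: opp_def)

lemma zero_noncentral: "0 < n" "0 \<noteq> opp 0"
  using two_le_n by (auto simp: opp_def)

lemma image_opp: "opp ` {..<n} = {..<n}"
  by (rule endo_inj_surj) (auto simp: inj_on_def opp_eq_iff)

lemma reflect_less [simp]: "t < n \<Longrightarrow> reflect A i t < n"
  by (simp add: reflect_def)

lemma reflect_eq_iff: "s < n \<Longrightarrow> t < n \<Longrightarrow> reflect A i s = reflect A i t \<longleftrightarrow> s = t"
  by (simp add: reflect_def opp_eq_iff)

lemma points_less: "x \<in> points \<Longrightarrow> i \<in> coords \<Longrightarrow> x i < n"
  by (auto simp: cube_def)

lemma points_eqI: "x \<in> points \<Longrightarrow> y \<in> points \<Longrightarrow> (\<And>i. i \<in> coords \<Longrightarrow> x i = y i) \<Longrightarrow> x = y"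
  unfolding cube_def by (rule PiE_ext)

lemma points_neqE:
  assumes "x \<in> points" "y \<in> points" "x \<noteq> y"
  obtains i where "i \<in> coords" "x i \<noteq> y i"
  using assms points_eqI by blast

lemma restrict_in_points: "(\<And>i. i \<in> coords \<Longrightarrow> h i < n) \<Longrightarrow> (\<lambda>i\<in>coords. h i) \<in> points"
  by (auto simp: cube_def)

lemma line_subset_points: "line L \<Longrightarrow> L \<subseteq> points"
  by (simp add: is_line_def)

lemma line_point_in_points: "x \<in> points \<Longrightarrow> S \<subseteq> coords \<Longrightarrow> t < n \<Longrightarrow> line_point x S A t \<in> points"
  by (auto simp: cube_def line_point_def PiE_iff extensional_def)

lemma line_point_in_param_line: "t < n \<Longrightarrow> line_point x S A t \<in> param_line x S A"
  by (simp add: param_line_def)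

lemma line_point_eq_iff:
  assumes "i \<in> S" "s < n" "t < n"
  shows "line_point x S A s = line_point x S A t \<longleftrightarrow> s = t"
proof
  assume "line_point x S A s = line_point x S A t"
  from fun_cong[OF this, of i] show "s = t" using assms by (simp add: line_point_def reflect_eq_iff)
qed simp

lemma line_point_self: "(\<And>i. i \<in> S \<Longrightarrow> x i = reflect A i t) \<Longrightarrow> line_point x S A t = x"
  by (auto simp: line_point_def)

lemma line_point_cong:
  assumes "A \<inter> S = B \<inter> S" "\<And>i. i \<notin> S \<Longrightarrow> x i = y i"
  shows "line_point x S A = line_point y S B"
  using assms by (fastforce simp: line_point_def reflect_def fun_eq_iff)

lemma param_line_compl: "param_line x S (- A) = param_line x S A"
proof -
  have "line_point x S (- A) t = line_point x S A (opp t)" if "t < n" for t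
    using that by (auto simp: line_point_def reflect_def)
  then have "param_line x S (- A) = line_point x S A ` opp ` {..<n}"
    by (auto simp: param_line_def image_image)
  then show ?thesis by (simp add: param_line_def image_opp)
qed

lemma nonconstant_line_coordinate:
  assumes "strict_mono_on {1..n} h \<or> strict_antimono_on {1..n} h"
    and "\<And>k. k \<in> {1..n} \<Longrightarrow> h k < n"
  shows "(\<forall>k<n. h (Suc k) = k) \<or> (\<forall>k<n. h (Suc k) = opp k)"
proof -
  have less: "h (Suc k) < n" if "k < n" for k using assms(2) that by simp
  from assms(1) show ?thesis
  proof
    assume "strict_mono_on {1..n} h"
    then have "strict_mono_on {..<n} (\<lambda>k. h (Suc k))" by (auto simp: monotone_on_def)
    then show ?thesis using strict_mono_on_lessThan_eq[of n "\<lambda>k. h (Suc k)", OF _ less] by blast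
  next
    assume "strict_antimono_on {1..n} h"
    then have "strict_antimono_on {..<n} (\<lambda>k. h (Suc k))" by (auto simp: monotone_on_def)
    then show ?thesis unfolding opp_def
      using strict_antimono_on_lessThan_eq[of n "\<lambda>k. h (Suc k)", OF _ less] by blast
  qed
qed

lemma lineE:
  assumes "line L"
  obtains x S A where "x \<in> points" "S \<subseteq> coords" "S \<noteq> {}" "L = param_line x S A"
proof -
  obtain q where q: "bij_betw q {1..n} L" and "L \<subseteq> points"
    and alt: "\<And>i. i \<in> coords \<Longrightarrow> strict_mono_on {1..n} (\<lambda>k. q k i) \<or>
                strict_antimono_on {1..n} (\<lambda>k. q k i) \<or> (\<exists>c. \<forall>k\<in>{1..n}. q k i = c)"
    and nonconst: "\<exists>i\<in>coords. \<not> (\<exists>c. \<forall>k\<in>{1..n}. q k i = c)"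
    using assms unfolding is_line_def by blast
  then have q_points: "q k \<in> points" if "k \<in> {1..n}" for k
    using that by (auto simp: bij_betw_def)
  define S where "S = {i \<in> coords. \<not> (\<exists>c. \<forall>k\<in>{1..n}. q k i = c)}"
  define A where "A = {i. \<exists>k<n. q (Suc k) i \<noteq> k}"
  have S: "S \<subseteq> coords" "S \<noteq> {}" using nonconst by (auto simp: S_def)
  have q1: "q 1 \<in> points" using q_points two_le_n by simp
  have q_eq: "q (Suc k) = line_point (q 1) S A k" if k: "k < n" for k
  proof (rule points_eqI)
    fix i assume i: "i \<in> coords"
    show "q (Suc k) i = line_point (q 1) S A k i"
    proof (cases "i \<in> S")
      case True
      then have "(\<forall>k<n. q (Suc k) i = k) \<or> (\<forall>k<n. q (Suc k) i = opp k)"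
        using alt[OF i] points_less[OF q_points i]
        by (intro nonconstant_line_coordinate) (auto simp: S_def)
      then show ?thesis using True k by (auto simp: line_point_def reflect_def A_def)
    next
      case False
      then obtain c where "\<forall>k\<in>{1..n}. q k i = c" using i by (auto simp: S_def)
      then show ?thesis using False k by (auto simp: line_point_def)
    qed
  qed (use q_points line_point_in_points[OF q1 S(1) k] k in auto)
  have "q ` Suc ` {..<n} = param_line (q 1) S A"
    unfolding param_line_def image_image by (rule image_cong[OF refl q_eq]) simp
  then have "L = param_line (q 1) S A" using q by (simp add: image_Suc_lessThan bij_betw_def)
  then show thesis using that q1 S by blast
qed

lemma line_point_coordinate:
  "strict_mono_on {1..n} (\<lambda>k. line_point x S A (k - 1) i) \<or>
    strict_antimono_on {1..n} (\<lambda>k. line_point x S A (k - 1) i) \<or>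
    (\<exists>c. \<forall>k\<in>{1..n}. line_point x S A (k - 1) i = c)"
proof -
  consider (increasing) "i \<in> S" "i \<notin> A" | (decreasing) "i \<in> S" "i \<in> A" | (nonvarying) "i \<notin> S"
    by blast
  then show ?thesis
  proof cases
    case increasing
    then have "strict_mono_on {1..n} (\<lambda>k. line_point x S A (k - 1) i)"
      by (auto simp: monotone_on_def line_point_def reflect_def)
    then show ?thesis by blast
  next
    case decreasing
    then have "strict_antimono_on {1..n} (\<lambda>k. line_point x S A (k - 1) i)"
      by (auto simp: monotone_on_def line_point_def reflect_def opp_def)
    then show ?thesis by blast
  qed (simp add: line_point_def)
qed

lemma line_param_line:
  assumes x: "x \<in> points" and S: "S \<subseteq> coords" "S \<noteq> {}"
  shows "line (param_line x S A)"
proof -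
  let ?q = "\<lambda>k. line_point x S A (k - 1)"
  obtain i where i: "i \<in> S" using S by blast
  have shift: "bij_betw (\<lambda>k. k - 1) {1..n} {..<n}"
    by (rule bij_betw_byWitness[where f' = Suc]) auto
  have "bij_betw (line_point x S A) {..<n} (param_line x S A)"
    using i by (auto simp: bij_betw_def inj_on_def param_line_def line_point_eq_iff)
  from bij_betw_trans[OF shift this] have "bij_betw ?q {1..n} (param_line x S A)"
    by (simp add: comp_def)
  moreover have "\<not> (\<exists>c. \<forall>k\<in>{1..n}. ?q k i = c)"
  proof
    assume "\<exists>c. \<forall>k\<in>{1..n}. ?q k i = c"
    then have "?q 1 i = ?q 2 i"
      using two_le_n by (metis atLeastAtMost_iff le_refl one_le_numeral order_trans)
    then show False using i two_le_n reflect_eq_iff[of 0 1 A i] by (simp add: line_point_def)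
  qed
  moreover have "param_line x S A \<subseteq> points"
    using x S line_point_in_points by (auto simp: param_line_def)
  ultimately show ?thesis
    unfolding is_line_def using line_point_coordinate i S(1) by blast
qed

subsection \<open>Collinear points\<close>

definition collinear :: "(nat \<Rightarrow> nat) \<Rightarrow> (nat \<Rightarrow> nat) \<Rightarrow> bool" where
  "collinear X Y \<longleftrightarrow> X = Y \<or> (\<exists>L. line L \<and> X \<in> L \<and> Y \<in> L)"

definition line_through :: "(nat \<Rightarrow> nat) \<Rightarrow> (nat \<Rightarrow> nat) \<Rightarrow> (nat \<Rightarrow> nat) set" where
  "line_through X Y = \<Union> {L. line L \<and> X \<in> L \<and> Y \<in> L}"

lemma line_eq_param_line:
  assumes "line L" "X \<in> L" "Y \<in> L" "X i \<noteq> Y i"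
  shows "L = param_line X {j. X j \<noteq> Y j} {j. X j \<noteq> X i \<or> Y j \<noteq> Y i}" (is "L = param_line X ?S ?A")
proof -
  obtain x S B where "L = param_line x S B" using assms(1) by (rule lineE)
  then obtain A where A: "i \<notin> A" "L = param_line x S A"
    using param_line_compl[of x S B] by (cases "i \<in> B") auto
  then obtain s t where st: "s < n" "t < n" "X = line_point x S A s" "Y = line_point x S A t"
    using assms(2,3) unfolding param_line_def by blast
  have "s \<noteq> t" "i \<in> S" using assms(4) st by (auto simp: line_point_def split: if_splits)
  then have S: "S = ?S" and i: "X i = s" "Y i = t"
    using st A(1)
    by (auto simp: line_point_def reflect_eq_iff reflect_def opp_eq_iff split: if_splits)
  have not_both_central: "opp s \<noteq> s \<or> opp t \<noteq> t"
    using central_unique[OF st(1,2)] \<open>s \<noteq> t\<close> by metis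
  have "j \<in> A \<longleftrightarrow> X j \<noteq> s \<or> Y j \<noteq> t" if "j \<in> S" for j
    using that not_both_central by (auto simp: st line_point_def reflect_def)
  then have "A \<inter> S = ?A \<inter> S" unfolding i by blast
  then have "line_point x S A = line_point X S ?A"
    by (rule line_point_cong) (simp add: st line_point_def)
  then show ?thesis using A(2) S by (simp add: param_line_def)
qed

lemma line_unique:
  assumes "line L" "line M" "X \<in> L" "Y \<in> L" "X \<in> M" "Y \<in> M" "X \<noteq> Y"
  shows "L = M"
proof -
  obtain i where "X i \<noteq> Y i" using assms(7) by blast
  from line_eq_param_line[OF assms(1,3,4) this] line_eq_param_line[OF assms(2,5,6) this]
  show ?thesis by simp
qed

lemma line_through_eq: "line L \<Longrightarrow> X \<in> L \<Longrightarrow> Y \<in> L \<Longrightarrow> X \<noteq> Y \<Longrightarrow> line_through X Y = L"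
  unfolding line_through_def using line_unique by blast

lemma collinear_refl: "collinear X X"
  by (simp add: collinear_def)

lemma collinear_sym: "collinear X Y \<Longrightarrow> collinear Y X"
  by (auto simp: collinear_def)

lemma collinearD:
  assumes "collinear X Y" "X i \<noteq> Y i" "X j \<noteq> Y j"
  shows "X i = X j \<and> Y i = Y j \<or> X i = opp (X j) \<and> Y i = opp (Y j)"
proof -
  obtain L where L: "line L" "X \<in> L" "Y \<in> L" using assms by (auto simp: collinear_def)
  from L(1) obtain x S A where "L = param_line x S A" by (rule lineE)
  then obtain s t where "s < n" "t < n" "X = line_point x S A s" "Y = line_point x S A t"
    using L unfolding param_line_def by blast
  then show ?thesis using assms(2,3) by (auto simp: line_point_def reflect_def split: if_splits)
qed

lemma collinearI:
  assumes "X \<in> points" "Y \<in> points"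
    and same_or_opp: "\<And>i j. i \<in> coords \<Longrightarrow> j \<in> coords \<Longrightarrow> X i \<noteq> Y i \<Longrightarrow> X j \<noteq> Y j \<Longrightarrow>
      X i = X j \<and> Y i = Y j \<or> X i = opp (X j) \<and> Y i = opp (Y j)"
  shows "collinear X Y"
proof (cases "X = Y")
  case False
  then obtain i where i: "i \<in> coords" "X i \<noteq> Y i" using assms points_neqE by metis
  define S where "S = {j \<in> coords. X j \<noteq> Y j}"
  define A where "A = {j. X j \<noteq> X i \<or> Y j \<noteq> Y i}"
  have S: "S \<subseteq> coords" "i \<in> S" using i by (auto simp: S_def)
  have less: "X i < n" "Y i < n" using points_less assms(1,2) i(1) by auto
  have on_S: "X j = reflect A j (X i) \<and> Y j = reflect A j (Y i)" if "j \<in> S" for j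
    using same_or_opp[of j i] i that by (auto simp: S_def A_def reflect_def)
  have "X = line_point X S A (X i)"
    using line_point_self[of S X A "X i"] on_S by auto
  moreover have "Y = line_point X S A (Y i)"
    by (rule points_eqI[OF assms(2) line_point_in_points[OF assms(1) S(1) less(2)]])
       (use on_S in \<open>auto simp: line_point_def S_def\<close>)
  ultimately have "X \<in> param_line X S A" "Y \<in> param_line X S A"
    using less line_point_in_param_line by metis+
  moreover have "line (param_line X S A)" using assms(1) S by (intro line_param_line) auto
  ultimately show ?thesis by (auto simp: collinear_def)
qed (simp add: collinear_refl)

lemma line_other_point:
  assumes "line L"
  shows "\<exists>Y\<in>L. Y \<noteq> X"
proof -
  obtain x S A where "S \<noteq> {}" and L: "L = param_line x S A" using assms by (rule lineE)
  then have "line_point x S A 0 \<noteq> line_point x S A (n - 1)"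
    using line_point_eq_iff[of _ S 0 "n - 1" x A] two_le_n by auto
  moreover have "line_point x S A 0 \<in> L" "line_point x S A (n - 1) \<in> L"
    using L line_point_in_param_line two_le_n by auto
  ultimately show ?thesis by metis
qed

subsection \<open>Line-preserving bijections\<close>

abbreviation line_auts :: "((nat \<Rightarrow> nat) \<Rightarrow> nat \<Rightarrow> nat) set" where
  "line_auts \<equiv> carrier (line_group n d)"

lemma line_auts_iff: "f \<in> line_auts \<longleftrightarrow> f \<in> Bij points \<and> (\<forall>L. line L \<longrightarrow> line (f ` L))"
  by (simp add: line_group_def)

lemma line_group_mult:
  "f \<in> line_auts \<Longrightarrow> g \<in> line_auts \<Longrightarrow> f \<otimes>\<^bsub>line_group n d\<^esub> g = compose points f g"
  by (simp add: line_group_def BijGroup_def)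

lemma line_auts_extensional: "f \<in> line_auts \<Longrightarrow> f \<in> extensional points"
  by (simp add: line_auts_iff Bij_def)

lemma line_auts_in_points: "f \<in> line_auts \<Longrightarrow> x \<in> points \<Longrightarrow> f x \<in> points"
  by (auto simp: line_auts_iff Bij_def bij_betw_def)

lemma line_auts_inj_on: "f \<in> line_auts \<Longrightarrow> inj_on f points"
  by (simp add: line_auts_iff Bij_def bij_betw_def)

lemma line_auts_eq_iff: "f \<in> line_auts \<Longrightarrow> x \<in> points \<Longrightarrow> y \<in> points \<Longrightarrow> f x = f y \<longleftrightarrow> x = y"
  using line_auts_inj_on by (auto simp: inj_on_def)

lemma line_auts_line: "f \<in> line_auts \<Longrightarrow> line L \<Longrightarrow> line (f ` L)"
  by (simp add: line_auts_iff)

lemma line_auts_inverse: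
  assumes "f \<in> line_auts"
  obtains g where "g \<in> line_auts" "\<And>x. x \<in> points \<Longrightarrow> g (f x) = x" "\<And>x. x \<in> points \<Longrightarrow> f (g x) = x"
proof -
  interpret group "line_group n d" by (rule group_line_group)
  define g where "g = inv\<^bsub>line_group n d\<^esub> f"
  have g: "g \<in> line_auts" using assms by (simp add: g_def)
  have "compose points g f = (\<lambda>x\<in>points. x)" "compose points f g = (\<lambda>x\<in>points. x)"
    using l_inv[OF assms] r_inv[OF assms] line_group_mult[OF g assms] line_group_mult[OF assms g]
    by (simp_all add: g_def line_group_def BijGroup_def)
  then have "g (f x) = x" "f (g x) = x" if "x \<in> points" for x
    using that by (metis compose_eq restrict_apply')+
  then show thesis using that g by blast
qed

lemma line_auts_factor:
  assumes "e \<in> line_auts" "f \<in> line_auts"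
  obtains g where "g \<in> line_auts" "f = compose points e g"
proof -
  interpret group "line_group n d" by (rule group_line_group)
  define g where "g = inv\<^bsub>line_group n d\<^esub> e \<otimes>\<^bsub>line_group n d\<^esub> f"
  have g: "g \<in> line_auts" using assms by (simp add: g_def)
  have "f = e \<otimes>\<^bsub>line_group n d\<^esub> g" using assms by (simp add: g_def flip: m_assoc)
  then show thesis using that g line_group_mult[OF assms(1) g] by simp
qed

lemma line_auts_preimage:
  assumes "f \<in> line_auts" "line L"
  obtains M where "line M" "L = f ` M"
proof -
  obtain g where g: "g \<in> line_auts" "\<And>x. x \<in> points \<Longrightarrow> f (g x) = x"
    using line_auts_inverse[OF assms(1)] by metis
  have "f ` g ` L = L"
    using g(2) line_subset_points[OF assms(2)] by (force simp: image_image)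
  then show thesis using that line_auts_line[OF g(1) assms(2)] by metis
qed

lemma line_auts_image_mem_iff:
  "f \<in> line_auts \<Longrightarrow> L \<subseteq> points \<Longrightarrow> x \<in> points \<Longrightarrow> f x \<in> f ` L \<longleftrightarrow> x \<in> L"
  using line_auts_inj_on inj_on_image_mem_iff by metis

lemma collinear_line_auts_iff:
  assumes f: "f \<in> line_auts" and XY: "X \<in> points" "Y \<in> points"
  shows "collinear (f X) (f Y) \<longleftrightarrow> collinear X Y"
proof -
  have preserved: "collinear (h x) (h y)" if "h \<in> line_auts" "collinear x y" for h x y
    using that line_auts_line[OF that(1)] by (auto simp: collinear_def)
  obtain g where "g \<in> line_auts" "g (f X) = X" "g (f Y) = Y"
    using line_auts_inverse[OF f] XY by metis
  then show ?thesis using preserved f by metis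
qed

lemma line_through_line_auts:
  assumes f: "f \<in> line_auts" and XY: "X \<in> points" "Y \<in> points"
  shows "line_through (f X) (f Y) = f ` line_through X Y"
proof -
  have "{L. line L \<and> f X \<in> L \<and> f Y \<in> L} = image f ` {L. line L \<and> X \<in> L \<and> Y \<in> L}"
  proof (intro equalityI subsetI)
    fix L assume L: "L \<in> {L. line L \<and> f X \<in> L \<and> f Y \<in> L}"
    then obtain M where M: "line M" "L = f ` M" using line_auts_preimage[OF f] by blast
    then have "X \<in> M" "Y \<in> M" using L line_auts_image_mem_iff[OF f line_subset_points] XY by auto
    then show "L \<in> image f ` {L. line L \<and> X \<in> L \<and> Y \<in> L}" using M by blast
  qed (use f line_auts_line in auto)
  then show ?thesis by (simp add: line_through_def image_Union)
qed

lemma line_through_subset_points: "line_through X Y \<subseteq> points"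
  using line_subset_points by (auto simp: line_through_def)

subsection \<open>Permuting and reflecting coordinates, permuting values\<close>

lemma sym_perms_iff: "p \<in> sym_perms n \<longleftrightarrow> p permutes {..<n} \<and> (\<forall>t<n. p (opp t) = opp (p t))"
  by (simp add: sym_perms_def opp_def diff_right_commute)

lemma sym_perms_permutes: "p \<in> sym_perms n \<Longrightarrow> p permutes {..<n}"
  by (simp add: sym_perms_iff)

lemma sym_perms_less: "p \<in> sym_perms n \<Longrightarrow> t < n \<Longrightarrow> p t < n"
  using permutes_in_image[OF sym_perms_permutes, of p t] by simp

lemma sym_perms_reflect: "p \<in> sym_perms n \<Longrightarrow> t < n \<Longrightarrow> p (reflect A i t) = reflect A i (p t)"
  by (simp add: reflect_def sym_perms_iff)

lemma id_in_sym_perms: "id \<in> sym_perms n"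
  by (simp add: sym_perms_iff permutes_id)

definition cube_map :: "(nat \<Rightarrow> nat) \<Rightarrow> nat set \<Rightarrow> (nat \<Rightarrow> nat) \<Rightarrow> (nat \<Rightarrow> nat) \<Rightarrow> nat \<Rightarrow> nat" where
  "cube_map s B p = (\<lambda>x\<in>points. \<lambda>i\<in>coords. reflect B i (p (x (s i))))"

lemma cube_map_apply: "x \<in> points \<Longrightarrow> i \<in> coords \<Longrightarrow> cube_map s B p x i = reflect B i (p (x (s i)))"
  by (simp add: cube_map_def)

lemma cube_map_in_points:
  assumes "s permutes coords" "p \<in> sym_perms n" "x \<in> points"
  shows "cube_map s B p x \<in> points"
proof -
  have "reflect B i (p (x (s i))) < n" if "i \<in> coords" for i
    using that points_less[OF assms(3)] sym_perms_less[OF assms(2)] permutes_in_image[OF assms(1)]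
    by simp
  then show ?thesis using assms(3) restrict_in_points by (simp add: cube_map_def)
qed

lemma cube_map_line_point:
  assumes s: "s permutes coords" and p: "p \<in> sym_perms n" and x: "x \<in> points" "S \<subseteq> coords" "t < n"
  shows "cube_map s B p (line_point x S A t) =
    line_point (cube_map s B p x) (s -` S) (sym_diff B (s -` A)) (p t)"
proof (rule points_eqI)
  show "line_point (cube_map s B p x) (s -` S) (sym_diff B (s -` A)) (p t) \<in> points"
    by (rule line_point_in_points[OF cube_map_in_points[OF s p x(1)]
          permutes_vimage_subset[OF s x(2)] sym_perms_less[OF p x(3)]])
  show "cube_map s B p (line_point x S A t) \<in> points"
    by (rule cube_map_in_points[OF s p line_point_in_points[OF x]])
  fix i assume "i \<in> coords"
  then show "cube_map s B p (line_point x S A t) i =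
    line_point (cube_map s B p x) (s -` S) (sym_diff B (s -` A)) (p t) i"
    using x(1) line_point_in_points[OF x] sym_perms_reflect[OF p x(3), of A]
      sym_perms_less[OF p x(3)]
    by (auto simp: cube_map_apply line_point_def reflect_def)
qed

lemma cube_map_in_Bij:
  assumes s: "s permutes coords" and p: "p \<in> sym_perms n"
  shows "cube_map s B p \<in> Bij points"
proof -
  have inj: "inj_on (cube_map s B p) points"
  proof (rule inj_onI)
    fix x y assume xy: "x \<in> points" "y \<in> points" "cube_map s B p x = cube_map s B p y"
    show "x = y"
    proof (rule points_eqI[OF xy(1,2)])
      fix j assume j: "j \<in> coords"
      then obtain i where i: "i \<in> coords" "j = s i" using permutes_image[OF s] by blast
      have "p (x j) < n" "p (y j) < n" using j xy points_less sym_perms_less[OF p] by auto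
      moreover have "reflect B i (p (x j)) = reflect B i (p (y j))"
        using cube_map_apply i xy by metis
      ultimately have "p (x j) = p (y j)" by (simp add: reflect_eq_iff)
      then show "x j = y j" using permutes_inj[OF sym_perms_permutes[OF p]] by (simp add: inj_eq)
    qed
  qed
  moreover have "cube_map s B p ` points = points"
    by (rule endo_inj_surj[OF finite_cube _ inj]) (use cube_map_in_points s p in auto)
  ultimately show ?thesis by (simp add: Bij_def bij_betw_def cube_map_def)
qed

lemma cube_map_in_line_auts:
  assumes s: "s permutes coords" and p: "p \<in> sym_perms n"
  shows "cube_map s B p \<in> line_auts"
  unfolding line_auts_iff
proof (intro conjI allI impI)
  fix L assume "line L"
  then obtain x S A where x: "x \<in> points" "S \<subseteq> coords" "S \<noteq> {}" and L: "L = param_line x S A"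
    by (rule lineE)
  have "cube_map s B p ` L =
      line_point (cube_map s B p x) (s -` S) (sym_diff B (s -` A)) ` p ` {..<n}"
    unfolding L param_line_def image_image using cube_map_line_point[OF s p x(1,2)]
    by (intro image_cong) auto
  also have "\<dots> = param_line (cube_map s B p x) (s -` S) (sym_diff B (s -` A))"
    using permutes_image[OF sym_perms_permutes[OF p]] by (simp add: param_line_def)
  finally show "line (cube_map s B p ` L)"
  proof (rule ssubst, intro line_param_line)
    show "s -` S \<subseteq> coords" by (rule permutes_vimage_subset[OF s x(2)])
    show "s -` S \<noteq> {}" using x(3) permutes_surj[OF s] by (metis ex_in_conv surjD vimageI)
  qed (rule cube_map_in_points[OF s p x(1)])
qed (rule cube_map_in_Bij[OF s p])

lemma compose_cube_map:
  assumes s: "s permutes coords" "s' permutes coords" and p: "p \<in> sym_perms n" "p' \<in> sym_perms n"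
  shows "compose points (cube_map s B p) (cube_map s' B' p') =
    cube_map (s' \<circ> s) (sym_diff B (s -` B')) (p \<circ> p')"
proof
  fix x show "compose points (cube_map s B p) (cube_map s' B' p') x =
    cube_map (s' \<circ> s) (sym_diff B (s -` B')) (p \<circ> p') x"
  proof (cases "x \<in> points")
    case x: True
    have x': "cube_map s' B' p' x \<in> points" by (rule cube_map_in_points[OF s(2) p(2) x])
    have "cube_map s B p (cube_map s' B' p' x) =
        cube_map (s' \<circ> s) (sym_diff B (s -` B')) (p \<circ> p') x"
    proof (rule points_eqI)
      fix i assume i: "i \<in> coords"
      then have si: "s i \<in> coords" "s' (s i) \<in> coords" using s by (simp_all only: permutes_in_image)
      then have v: "p' (x (s' (s i))) < n" using points_less[OF x] sym_perms_less[OF p(2)] by blast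
      show "cube_map s B p (cube_map s' B' p' x) i =
          cube_map (s' \<circ> s) (sym_diff B (s -` B')) (p \<circ> p') x i"
        using i si x x' sym_perms_reflect[OF p(1) v] sym_perms_less[OF p(1) v]
        by (auto simp: cube_map_apply reflect_def)
    qed (intro cube_map_in_points permutes_compose sym_perms_comp s p x x')+
    then show ?thesis using x by (simp add: compose_eq)
  qed (simp add: compose_def cube_map_def)
qed

subsection \<open>Main diagonals\<close>

definition diag_point :: "nat set \<Rightarrow> nat \<Rightarrow> nat \<Rightarrow> nat" where
  "diag_point A t = (\<lambda>i\<in>coords. reflect A i t)"

definition main_diagonal :: "nat set \<Rightarrow> (nat \<Rightarrow> nat) set" where
  "main_diagonal A = diag_point A ` {..<n}"

definition diagonal_points :: "(nat \<Rightarrow> nat) set" where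
  "diagonal_points = {diag_point A t | A t. A \<subseteq> coords \<and> t < n}"

definition noncentral_diagonal_points :: "(nat \<Rightarrow> nat) set" where
  "noncentral_diagonal_points = {diag_point A t | A t. A \<subseteq> coords \<and> t < n \<and> t \<noteq> opp t}"

lemma diag_point_in_points [simp]: "t < n \<Longrightarrow> diag_point A t \<in> points"
  unfolding diag_point_def by (rule restrict_in_points) simp

lemma diag_point_apply: "i \<in> coords \<Longrightarrow> diag_point A t i = reflect A i t"
  by (simp add: diag_point_def)

lemma diag_point_compl: "t < n \<Longrightarrow> diag_point (coords - A) t = diag_point A (opp t)"
  by (auto simp: diag_point_def reflect_def fun_eq_iff)

lemma main_diagonal_subset_points: "main_diagonal A \<subseteq> points"
  by (auto simp: main_diagonal_def)

lemma noncentral_diagonal_points_subset_points: "noncentral_diagonal_points \<subseteq> points"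
  by (auto simp: noncentral_diagonal_points_def)

lemma noncentral_subset_diagonal_points: "noncentral_diagonal_points \<subseteq> diagonal_points"
  by (auto simp: noncentral_diagonal_points_def diagonal_points_def)

lemma param_line_coords:
  assumes "x \<in> points"
  shows "param_line x coords A = main_diagonal A"
proof -
  have "line_point x coords A t = diag_point A t" if "t < n" for t
    by (rule points_eqI[OF line_point_in_points[OF assms subset_refl that]
          diag_point_in_points[OF that]]) (simp add: line_point_def diag_point_apply)
  then show ?thesis by (auto simp: param_line_def main_diagonal_def)
qed

lemma cube_map_diag_point:
  assumes "s permutes coords" "p \<in> sym_perms n" "t < n"
  shows "cube_map s B p (diag_point A t) = diag_point (sym_diff B (s -` A)) (p t)"
proof (rule points_eqI)
  fix i assume i: "i \<in> coords"
  then have "s i \<in> coords" using permutes_in_image[OF assms(1)] by blast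
  then show "cube_map s B p (diag_point A t) i = diag_point (sym_diff B (s -` A)) (p t) i"
    using i assms(3) sym_perms_reflect[OF assms(2,3)] sym_perms_less[OF assms(2,3)]
    by (auto simp: cube_map_apply diag_point_apply reflect_def)
qed (use assms cube_map_in_points sym_perms_less in auto)

lemma collinear_diag_points:
  "s < n \<Longrightarrow> t = s \<or> t = opp s \<Longrightarrow> collinear (diag_point A s) (diag_point B t)"
  by (rule collinearI) (auto simp: diag_point_apply reflect_def)

lemma collinear_diag_points_imp_same_level:
  assumes "A \<subseteq> coords" "B \<subseteq> coords" "A \<noteq> B" "A \<noteq> coords - B"
    and st: "s < n" "t < n" "s \<noteq> opp s" "t \<noteq> opp t"
    and coll: "collinear (diag_point A s) (diag_point B t)"
  shows "t = s \<or> t = opp s"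
proof (rule ccontr)
  assume other_level: "\<not> (t = s \<or> t = opp s)"
  obtain i j where ij: "i \<in> coords" "(i \<in> A) \<noteq> (i \<in> B)" "j \<in> coords" "(j \<in> A) = (j \<in> B)"
    using assms(1-4) by blast
  have "diag_point A s k \<noteq> diag_point B t k" if "k \<in> coords" for k
    using other_level that st by (auto simp: diag_point_apply reflect_def opp_eq_iff)
  from collinearD[OF coll this this, OF ij(1,3)] show False
    using ij st by (auto simp: diag_point_apply reflect_def split: if_splits)
qed

subsection \<open>Transversals\<close>

definition transversals ::
    "(nat \<Rightarrow> nat) \<Rightarrow> (nat \<Rightarrow> nat) set \<Rightarrow> (nat \<Rightarrow> nat) set \<Rightarrow> ((nat \<Rightarrow> nat) \<times> (nat \<Rightarrow> nat)) set" where
  "transversals P L M = {(X, Y). X \<in> L - {P} \<and> Y \<in> M - {P} \<and> X \<noteq> Y \<and> collinear X Y}"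

definition never_0_2_transversals :: "(nat \<Rightarrow> nat) \<Rightarrow> bool" where
  "never_0_2_transversals P \<longleftrightarrow>
    (\<forall>L M. line L \<longrightarrow> line M \<longrightarrow> P \<in> L \<longrightarrow> P \<in> M \<longrightarrow> L \<noteq> M \<longrightarrow> card (transversals P L M) \<notin> {0, 2})"

lemma card_transversals_commute: "card (transversals P M L) = card (transversals P L M)"
proof -
  have "transversals P M L = (transversals P L M)\<inverse>"
    using collinear_sym by (auto simp: transversals_def)
  then show ?thesis by simp
qed

lemma transversals_line_auts:
  assumes f: "f \<in> line_auts" and P: "P \<in> points" and L: "L \<subseteq> points" "M \<subseteq> points"
  shows "transversals (f P) (f ` L) (f ` M) = map_prod f f ` transversals P L M"
proof -
  have "(f X, f Y) \<in> transversals (f P) (f ` L) (f ` M) \<longleftrightarrow> (X, Y) \<in> transversals P L M"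
    if "X \<in> L" "Y \<in> M" for X Y
  proof -
    have "X \<in> points" "Y \<in> points" using that L by auto
    then show ?thesis
      using that P line_auts_eq_iff[OF f] collinear_line_auts_iff[OF f]
      by (simp add: transversals_def)
  qed
  moreover have "transversals P L M \<subseteq> L \<times> M" by (auto simp: transversals_def)
  moreover have "transversals (f P) (f ` L) (f ` M) \<subseteq> map_prod f f ` (L \<times> M)"
    by (auto simp: transversals_def)
  ultimately show ?thesis by fastforce
qed

lemma card_transversals_line_auts:
  assumes f: "f \<in> line_auts" and P: "P \<in> points" and L: "L \<subseteq> points" "M \<subseteq> points"
  shows "card (transversals (f P) (f ` L) (f ` M)) = card (transversals P L M)"
  unfolding transversals_line_auts[OF assms]
proof (rule card_image)
  have "inj_on (map_prod f f) (points \<times> points)"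
    using line_auts_inj_on[OF f] by (intro map_prod_inj_on)
  then show "inj_on (map_prod f f) (transversals P L M)"
    by (rule inj_on_subset) (use L in \<open>auto simp: transversals_def\<close>)
qed

lemma never_0_2_transversals_line_auts:
  assumes f: "f \<in> line_auts" and P: "P \<in> points" "never_0_2_transversals P"
  shows "never_0_2_transversals (f P)"
  unfolding never_0_2_transversals_def
proof (intro allI impI)
  fix L' M' assume LM': "line L'" "line M'" "f P \<in> L'" "f P \<in> M'" "L' \<noteq> M'"
  obtain L where L: "line L" "L' = f ` L" using line_auts_preimage[OF f LM'(1)] .
  obtain M where M: "line M" "M' = f ` M" using line_auts_preimage[OF f LM'(2)] .
  note subset = line_subset_points[OF L(1)] line_subset_points[OF M(1)]
  have "P \<in> L" "P \<in> M" "L \<noteq> M"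
    using LM' L M P line_auts_image_mem_iff[OF f] subset by auto
  then have "card (transversals P L M) \<notin> {0, 2}"
    using P L M unfolding never_0_2_transversals_def by blast
  then show "card (transversals (f P) L' M') \<notin> {0, 2}"
    using card_transversals_line_auts[OF f P(1) subset] L M by simp
qed

subsection \<open>Pencils of lines through a point of a main diagonal\<close>

abbreviation pencil_point :: "nat set \<Rightarrow> nat \<Rightarrow> nat set \<Rightarrow> nat \<Rightarrow> nat \<Rightarrow> nat" where
  "pencil_point A a S \<equiv> line_point (diag_point A a) S A"

abbreviation pencil_line :: "nat set \<Rightarrow> nat \<Rightarrow> nat set \<Rightarrow> (nat \<Rightarrow> nat) set" where
  "pencil_line A a S \<equiv> param_line (diag_point A a) S A"

lemma pencil_point_apply:
  "i \<in> coords \<Longrightarrow> pencil_point A a S t i = reflect A i (if i \<in> S then t else a)"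
  by (simp add: line_point_def diag_point_apply)

lemma pencil_point_base: "S \<subseteq> coords \<Longrightarrow> pencil_point A a S a = diag_point A a"
  by (rule line_point_self) (auto simp: diag_point_apply)

lemma pencil_point_opp:
  assumes "S \<subseteq> coords" "t < n"
  shows "pencil_point A t S (opp t) = diag_point (sym_diff A S) t"
proof (rule points_eqI)
  show "pencil_point A t S (opp t) \<in> points" using assms by (simp add: line_point_in_points)
  show "pencil_point A t S (opp t) i = diag_point (sym_diff A S) t i" if "i \<in> coords" for i
    using that assms by (auto simp: pencil_point_apply diag_point_apply reflect_def)
qed (use assms in simp)

lemma diag_points_in_pencil_line:
  assumes "S \<subseteq> coords" "t < n"
  shows "diag_point A t \<in> pencil_line A t S" "diag_point (sym_diff A S) t \<in> pencil_line A t S"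
  using line_point_in_param_line[of t "diag_point A t" S A]
    line_point_in_param_line[of "opp t" "diag_point A t" S A]
    pencil_point_base pencil_point_opp assms by auto

lemma line_pencil_line: "S \<subseteq> coords \<Longrightarrow> S \<noteq> {} \<Longrightarrow> t < n \<Longrightarrow> line (pencil_line A t S)"
  by (simp add: line_param_line)

lemma line_through_diag_point:
  assumes L: "line L" "diag_point A a \<in> L" and a: "a < n" "a \<noteq> opp a"
  obtains S where "S \<subseteq> coords" "S \<noteq> {}" "L = pencil_line A a S"
proof -
  let ?P = "diag_point A a"
  obtain Y where Y: "Y \<in> L" "Y \<noteq> ?P" using line_other_point[OF L(1)] by blast
  have points: "?P \<in> points" "Y \<in> points" using L Y line_subset_points by auto
  then obtain i where i: "i \<in> coords" "?P i \<noteq> Y i" using Y(2) points_neqE by metis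
  define S where "S = {j. ?P j \<noteq> Y j}"
  define D where "D = {j. ?P j \<noteq> ?P i \<or> Y j \<noteq> Y i}"
  have "?P j = Y j" if "j \<notin> coords" for j using points that by (metis PiE_arb cube_def)
  then have S: "S \<subseteq> coords" "i \<in> S" using i(2) unfolding S_def by blast+
  have "collinear ?P Y" using L Y by (auto simp: collinear_def)
  then have same_or_opp: "?P j = ?P i \<and> Y j = Y i \<or> ?P j = opp (?P i)" if "j \<in> S" for j
    using collinearD[of ?P Y j i] that i(2) unfolding S_def by blast
  have P_eq_iff: "?P j = ?P i \<longleftrightarrow> (j \<in> A \<longleftrightarrow> i \<in> A)" "?P i \<noteq> opp (?P i)" if "j \<in> coords" for j
    using that i(1) a by (simp_all add: diag_point_apply reflect_def)
  have "j \<in> D \<longleftrightarrow> (j \<in> A) \<noteq> (i \<in> A)" if "j \<in> S" for j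
    using same_or_opp[OF that] P_eq_iff[of j] that S(1) unfolding D_def by auto
  then have "D \<inter> S = A \<inter> S \<or> D \<inter> S = - A \<inter> S" by blast
  then have "line_point ?P S D = line_point ?P S A \<or> line_point ?P S D = line_point ?P S (- A)"
    by (metis line_point_cong)
  then have "param_line ?P S D = pencil_line A a S"
    using param_line_compl by (metis param_line_def)
  moreover have "L = param_line ?P S D"
    unfolding S_def D_def by (rule line_eq_param_line[of L ?P Y i]) (use L Y i in auto)
  ultimately show thesis using that S by blast
qed

lemma collinear_pencil_points:
  assumes "a < n" "s < n" "S \<subseteq> coords" "T \<subseteq> coords" "s = opp a \<or> comparable S T"
  shows "collinear (pencil_point A a S s) (pencil_point A a T s)"
  by (rule collinearI)
     (use assms in \<open>auto simp: pencil_point_apply reflect_def line_point_in_points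
        split: if_splits\<close>)

lemma collinear_pencil_points_central:
  assumes "a < n" "c < n" "c = opp c" "S \<subseteq> T" "T \<subseteq> coords"
  shows "collinear (pencil_point A a S (opp a)) (pencil_point A a T c)"
  by (rule collinearI)
     (use assms in \<open>auto simp: pencil_point_apply reflect_def line_point_in_points
        split: if_splits\<close>)

lemma collinear_pencil_points_incomparable:
  assumes "a < n" "a \<noteq> opp a" "s < n" "t < n" "s \<noteq> a" "t \<noteq> a"
    and ST: "S \<subseteq> coords" "T \<subseteq> coords" "\<not> comparable S T"
    and coll: "collinear (pencil_point A a S s) (pencil_point A a T t)"
  shows "s = opp a \<and> t = opp a"
proof -
  obtain i j where ij: "i \<in> S" "i \<notin> T" "i \<in> coords" "j \<in> T" "j \<notin> S" "j \<in> coords" using ST by blast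
  have "pencil_point A a S s k \<noteq> pencil_point A a T t k" if "k = i \<or> k = j" for k
    using that ij assms(1-6) by (auto simp: pencil_point_apply reflect_eq_iff)
  from collinearD[OF coll this this, of i j] show ?thesis
    using ij assms(1-6) by (auto simp: pencil_point_apply reflect_def opp_eq_iff split: if_splits)
qed

lemma card_transversals_pencil_lines:
  assumes a: "a < n" and ST: "S \<subseteq> coords" "T \<subseteq> coords" "S \<noteq> {}" "\<not> T \<subseteq> S"
  shows "card (transversals (diag_point A a) (pencil_line A a S) (pencil_line A a T)) =
    card {(s, t). s \<in> {..<n} - {a} \<and> t \<in> {..<n} - {a} \<and>
      collinear (pencil_point A a S s) (pencil_point A a T t)}"
    (is "card ?T = card ?U")
proof -
  obtain i j where ij: "i \<in> S" "i \<in> coords" "j \<in> T" "j \<notin> S" "j \<in> coords" using ST by blast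
  let ?pair = "\<lambda>(s, t). (pencil_point A a S s, pencil_point A a T t)"
  have base: "pencil_point A a S s = diag_point A a \<longleftrightarrow> s = a"
    "pencil_point A a T s = diag_point A a \<longleftrightarrow> s = a"
    if "s < n" for s
    using line_point_eq_iff[OF ij(1) that a] line_point_eq_iff[OF ij(3) that a]
      pencil_point_base ST(1,2) by metis+
  have ne: "pencil_point A a S s \<noteq> pencil_point A a T t" if "t < n" "t \<noteq> a" for s t
  proof
    assume "pencil_point A a S s = pencil_point A a T t"
    from fun_cong[OF this, of j] show False
      using that a ij by (simp add: pencil_point_apply reflect_eq_iff)
  qed
  have "?T = ?pair ` ?U"
    using base ne unfolding transversals_def param_line_def by (auto simp: image_iff)
  moreover have "inj_on ?pair ?U"
    by (rule inj_onI) (use ij line_point_eq_iff in auto)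
  ultimately show ?thesis by (simp add: card_image)
qed

lemma card_transversals_incomparable:
  assumes a: "a < n" "a \<noteq> opp a" and ST: "S \<subseteq> coords" "T \<subseteq> coords" "\<not> comparable S T"
  shows "card (transversals (diag_point A a) (pencil_line A a S) (pencil_line A a T)) = 1"
proof -
  have "collinear (pencil_point A a S s) (pencil_point A a T t) \<longleftrightarrow> s = opp a \<and> t = opp a"
    if "s < n" "t < n" "s \<noteq> a" "t \<noteq> a" for s t
    using collinear_pencil_points_incomparable[OF a that ST]
      collinear_pencil_points[of a "opp a" S T A] a ST
    by auto
  then have "{(s, t). s \<in> {..<n} - {a} \<and> t \<in> {..<n} - {a} \<and>
      collinear (pencil_point A a S s) (pencil_point A a T t)} = {(opp a, opp a)}"
    using a by auto
  moreover have "S \<noteq> {}" "\<not> T \<subseteq> S" using ST(3) by auto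
  ultimately show ?thesis
    using card_transversals_pencil_lines[OF a(1) ST(1,2), of A] by simp
qed

subsection \<open>Transversals of axis-parallel lines\<close>

definition axis_line :: "(nat \<Rightarrow> nat) \<Rightarrow> nat \<Rightarrow> (nat \<Rightarrow> nat) set" where
  "axis_line P i = (\<lambda>s. P(i := s)) ` {..<n}"

lemma axis_line_eq_param_line: "axis_line P i = param_line P {i} {}"
proof -
  have "line_point P {i} {} = (\<lambda>s. P(i := s))"
    by (auto simp: line_point_def reflect_def fun_eq_iff)
  then show ?thesis by (simp add: axis_line_def param_line_def)
qed

lemma line_axis_line: "P \<in> points \<Longrightarrow> i \<in> coords \<Longrightarrow> line (axis_line P i)"
  unfolding axis_line_eq_param_line by (rule line_param_line) auto

lemma base_in_axis_line: "P \<in> points \<Longrightarrow> i \<in> coords \<Longrightarrow> P \<in> axis_line P i"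
  unfolding axis_line_def by (rule image_eqI[of _ _ "P i"]) (use points_less in auto)

lemma axis_lines_neq:
  assumes "i \<noteq> j"
  shows "axis_line P i \<noteq> axis_line P j"
proof
  assume eq: "axis_line P i = axis_line P j"
  obtain s where s: "s < n" "s \<noteq> P i" using zero_noncentral opp_less by metis
  then have "P(i := s) \<in> axis_line P i" unfolding axis_line_def by blast
  then have "P(i := s) \<in> axis_line P j" using eq by simp
  then obtain t where "P(i := s) = P(j := t)" unfolding axis_line_def by blast
  from fun_cong[OF this, of i] show False using s(2) assms by simp
qed

lemma collinear_axis_points_iff:
  assumes P: "P \<in> points" and ij: "i \<in> coords" "j \<in> coords" "i \<noteq> j"
    and st: "s < n" "t < n" "s \<noteq> P i" "t \<noteq> P j"
  shows "collinear (P(i := s)) (P(j := t)) \<longleftrightarrow> s = P j \<and> t = P i \<or> s = opp (P j) \<and> t = opp (P i)"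
proof
  assume "collinear (P(i := s)) (P(j := t))"
  from collinearD[OF this, of i j] show "s = P j \<and> t = P i \<or> s = opp (P j) \<and> t = opp (P i)"
    using st ij(3) by auto
next
  assume exchanged: "s = P j \<and> t = P i \<or> s = opp (P j) \<and> t = opp (P i)"
  have less: "P i < n" "P j < n" using points_less[OF P] ij by auto
  show "collinear (P(i := s)) (P(j := t))"
  proof (rule collinearI)
    show "P(i := s) \<in> points" "P(j := t) \<in> points"
      using P ij st by (auto simp: cube_def PiE_def extensional_def)
    fix k l assume "(P(i := s)) k \<noteq> (P(j := t)) k" "(P(i := s)) l \<noteq> (P(j := t)) l"
    then have "k = i \<or> k = j" "l = i \<or> l = j" by (auto split: if_splits)
    then show "(P(i := s)) k = (P(i := s)) l \<and> (P(j := t)) k = (P(j := t)) l \<or>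
      (P(i := s)) k = opp ((P(i := s)) l) \<and> (P(j := t)) k = opp ((P(j := t)) l)"
      using exchanged ij(3) less by auto
  qed
qed

lemma card_transversals_axis_lines:
  assumes P: "P \<in> points" and ij: "i \<in> coords" "j \<in> coords" "i \<noteq> j"
  shows "card (transversals P (axis_line P i) (axis_line P j)) =
    card ({(P j, P i), (opp (P j), opp (P i))} - {(P i, P j)})" (is "card ?T = card ?U")
proof -
  let ?pair = "\<lambda>(s, t). (P(i := s), P(j := t))"
  have less: "P i < n" "P j < n" using points_less[OF P] ij by auto
  have base: "P(k := s) = P \<longleftrightarrow> s = P k" for k s by (metis fun_upd_same fun_upd_triv)
  have ne: "P(i := s) \<noteq> P(j := t)" if "s \<noteq> P i" for s t
    using that ij(3) by (metis fun_upd_other fun_upd_same)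
  have "?T = ?pair ` {(s, t). s < n \<and> t < n \<and> s \<noteq> P i \<and> t \<noteq> P j \<and>
      collinear (P(i := s)) (P(j := t))}"
    using base ne unfolding transversals_def axis_line_def by (auto simp: image_iff)
  also have "{(s, t). s < n \<and> t < n \<and> s \<noteq> P i \<and> t \<noteq> P j \<and> collinear (P(i := s)) (P(j := t))} =
    {(s, t). s < n \<and> t < n \<and> s \<noteq> P i \<and> t \<noteq> P j \<and>
      (s = P j \<and> t = P i \<or> s = opp (P j) \<and> t = opp (P i))}"
    using collinear_axis_points_iff[OF P ij] by blast
  also have "\<dots> = ?U" using less by (auto dest: arg_cong[of _ _ opp])
  finally have "?T = ?pair ` ?U" .
  moreover have "inj_on ?pair ?U"
    by (rule inj_onI) (auto dest: fun_cong[of _ _ i] fun_cong[of _ _ j])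
  ultimately show ?thesis by (simp add: card_image)
qed

subsection \<open>Shifting a level\<close>

definition level :: "nat \<Rightarrow> nat" where
  "level t = min t (opp t)"

abbreviation levels :: "(nat \<Rightarrow> nat) \<Rightarrow> nat set" where
  "levels x \<equiv> (\<lambda>k. level (x k)) ` coords"

definition shift_level :: "(nat \<Rightarrow> nat) \<Rightarrow> nat \<Rightarrow> nat \<Rightarrow> nat \<Rightarrow> nat" where
  "shift_level x j = line_point x {k \<in> coords. level (x k) = level (x j)} {k. x k \<noteq> x j}"

lemma level_eq_iff: "s < n \<Longrightarrow> t < n \<Longrightarrow> level s = level t \<longleftrightarrow> s = t \<or> s = opp t"
  by (auto simp: level_def opp_def min_def split: if_splits)

lemma level_reflect: "t < n \<Longrightarrow> level (reflect A i t) = level t"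
  by (auto simp: level_def reflect_def)

lemma shift_level_in_points: "x \<in> points \<Longrightarrow> v < n \<Longrightarrow> shift_level x j v \<in> points"
  unfolding shift_level_def by (rule line_point_in_points) auto

lemma shift_level_self:
  assumes "x \<in> points" "j \<in> coords"
  shows "shift_level x j (x j) = x"
  unfolding shift_level_def
proof (rule line_point_self)
  fix k assume "k \<in> {k \<in> coords. level (x k) = level (x j)}"
  then have "x k = x j \<or> x k = opp (x j)" using level_eq_iff points_less assms by blast
  then show "x k = reflect {k. x k \<noteq> x j} k (x j)" by (auto simp: reflect_def)
qed

lemma shift_level_at: "j \<in> coords \<Longrightarrow> shift_level x j v j = v"
  by (simp add: shift_level_def line_point_def reflect_def)

lemma shift_level_other: "level (x i) \<noteq> level (x j) \<Longrightarrow> shift_level x j v i = x i"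
  by (simp add: shift_level_def line_point_def)

lemma line_shift_level: "x \<in> points \<Longrightarrow> j \<in> coords \<Longrightarrow> line (shift_level x j ` {..<n})"
  unfolding shift_level_def param_line_def[symmetric] by (rule line_param_line) auto

lemma card_levels_shift_level_less:
  assumes ij: "i \<in> coords" "j \<in> coords" "level (x i) \<noteq> level (x j)"
    and v: "v < n" "level v = level (x i)"
  shows "card (levels (shift_level x j v)) < card (levels x)"
proof (rule psubset_card_mono)
  have "levels (shift_level x j v) \<subseteq> levels x - {level (x j)}"
    using ij v by (auto simp: shift_level_def line_point_def level_reflect split: if_splits)
  also have "\<dots> \<subset> levels x" using imageI[OF ij(2), of "\<lambda>k. level (x k)"] by blast
  finally show "levels (shift_level x j v) \<subset> levels x" .
qed simp

lemma collinear_shift_levels: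
  assumes "x \<in> points" "i \<in> coords" "u < n" "v < n"
  shows "collinear (shift_level x i u) (shift_level x i v)"
  using line_shift_level[OF assms(1,2)] assms(3,4) unfolding collinear_def by blast

lemma collinear_shift_levels_imp:
  assumes ij: "i \<in> coords" "j \<in> coords" "level (x i) \<noteq> level (x j)" and v: "v < n"
    and coll: "collinear (shift_level x j v) (shift_level x i (x j))"
  shows "v = x j \<or> v = x i \<or> v = opp (x i)"
proof -
  have "shift_level x j v i = x i" "shift_level x j v j = v"
    "shift_level x i (x j) i = x j" "shift_level x i (x j) j = x j"
    using shift_level_at shift_level_other ij by auto
  then have "v = x j \<or> x i = v \<or> x i = opp v" using collinearD[OF coll, of i j] ij(3) by metis
  then show ?thesis using v by auto
qed

lemma fixed_if_shift_levels_fixed: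
  assumes g: "g \<in> line_auts" and x: "x \<in> points"
    and ij: "i \<in> coords" "j \<in> coords" "level (x i) \<noteq> level (x j)" "x i \<noteq> opp (x i)"
    and fixed: "g (shift_level x j (x i)) = shift_level x j (x i)"
      "g (shift_level x j (opp (x i))) = shift_level x j (opp (x i))"
      "g (shift_level x i (x j)) = shift_level x i (x j)"
  shows "g x = x"
proof -
  let ?L = "shift_level x j ` {..<n}"
  have less: "x i < n" "x j < n" using points_less[OF x] ij by auto
  have on_L: "shift_level x j (x i) \<in> ?L" "shift_level x j (opp (x i)) \<in> ?L" "x \<in> ?L"
    using less shift_level_self[OF x ij(2)] by (auto, metis imageI lessThan_iff)
  have "g ` ?L = ?L"
  proof (rule line_unique[OF line_auts_line[OF g] _ _ _ on_L(1,2)])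
    show "line ?L" by (rule line_shift_level[OF x ij(2)])
    then show "line ?L" .
    show "shift_level x j (x i) \<in> g ` ?L" "shift_level x j (opp (x i)) \<in> g ` ?L"
      using on_L fixed by (metis imageI)+
    show "shift_level x j (x i) \<noteq> shift_level x j (opp (x i))" using shift_level_at ij by metis
  qed
  then obtain v where v: "v < n" "g x = shift_level x j v" using on_L(3) by blast
  have "collinear x (shift_level x i (x j))"
    using collinear_shift_levels[OF x ij(1) less] shift_level_self[OF x ij(1)] by simp
  then have "collinear (shift_level x j v) (shift_level x i (x j))"
    using collinear_line_auts_iff[OF g x shift_level_in_points[OF x less(2)]] fixed(3) v(2) by metis
  from collinear_shift_levels_imp[OF ij(1-3) v(1) this]
  show ?thesis
  proof
    assume "v = x j"
    then show ?thesis using v(2) shift_level_self[OF x ij(2)] by simp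
  next
    assume "v = x i \<or> v = opp (x i)"
    then have "g (shift_level x j v) = g x" using fixed(1,2) v(2) by auto
    then show ?thesis
      using line_auts_eq_iff[OF g shift_level_in_points[OF x v(1)] x] v(2) by simp
  qed
qed

section \<open>Orders of the coordinate and rotation groups\<close>

subsection \<open>The parameters of a cube map\<close>

lemma cube_map_eq_imp_permutation_eq:
  assumes s: "s permutes coords" "s' permutes coords" and p: "p \<in> sym_perms n"
    and eq: "cube_map s B p = cube_map s' B' p'"
  shows "s = s'"
proof
  fix i show "s i = s' i"
  proof (cases "i \<in> coords")
    case i: True
    show ?thesis
    proof (rule ccontr)
      assume ne: "s i \<noteq> s' i"
      let ?x = "line_point (diag_point {} 0) {s i} {}"
      have si: "s i \<in> coords" "s' i \<in> coords" using i s by (simp_all only: permutes_in_image)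
      have "reflect B i (p t) = reflect B' i (p' 0)" if t: "t < n" for t
      proof -
        have "?x t \<in> points" using si(1) t zero_noncentral by (intro line_point_in_points) auto
        then have "cube_map s B p (?x t) i = reflect B i (p (?x t (s i)))"
          "cube_map s' B' p' (?x t) i = reflect B' i (p' (?x t (s' i)))"
          using i cube_map_apply by blast+
        then show ?thesis
          using eq ne si(2) by (simp add: line_point_def reflect_def diag_point_apply)
      qed
      then have "reflect B i (p 0) = reflect B i (p (opp 0))" using zero_noncentral by simp
      then have "p 0 = p (opp 0)"
        using sym_perms_less[OF p] zero_noncentral by (simp add: reflect_eq_iff)
      then show False
        using permutes_inj[OF sym_perms_permutes[OF p]] zero_noncentral by (simp add: inj_eq)
    qed
  qed (use s permutes_not_in in metis)
qed

lemma cube_map_eq_imp_reflect_eq: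
  assumes s: "s permutes coords" "s' permutes coords" and eq: "cube_map s B p = cube_map s' B' p'"
    and i: "i \<in> coords" "t < n"
  shows "reflect B i (p t) = reflect B' i (p' t)"
proof -
  have "s i \<in> coords" "s' i \<in> coords" using i(1) s by (simp_all only: permutes_in_image)
  then have "diag_point {} t (s i) = t" "diag_point {} t (s' i) = t"
    by (simp_all only: diag_point_apply) (simp_all add: reflect_def)
  then have "cube_map s B p (diag_point {} t) i = reflect B i (p t)"
    "cube_map s' B' p' (diag_point {} t) i = reflect B' i (p' t)"
    using i cube_map_apply diag_point_in_points by metis+
  then show ?thesis using eq by simp
qed

lemma cube_map_eq_imp_value_permutation_eq:
  assumes s: "s permutes coords" "s' permutes coords" and p: "p \<in> sym_perms n" "p' \<in> sym_perms n"
    and eq: "cube_map s B p = cube_map s' B' p'" and i: "i \<in> coords" "i \<in> B \<longleftrightarrow> i \<in> B'"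
  shows "p = p'"
proof
  fix t show "p t = p' t"
  proof (cases "t < n")
    case True
    then have "reflect B i (p t) = reflect B i (p' t)"
      using cube_map_eq_imp_reflect_eq[OF s eq i(1)] i(2) by (simp add: reflect_def)
    then show ?thesis using sym_perms_less p True by (simp add: reflect_eq_iff)
  next
    case False
    then show ?thesis using p sym_perms_permutes permutes_not_in by (metis lessThan_iff)
  qed
qed

lemma cube_map_eq_imp_reflections_eq:
  assumes s: "s permutes coords" "s' permutes coords" and p: "p \<in> sym_perms n"
    and B: "B \<subseteq> coords" "B' \<subseteq> coords" and eq: "cube_map s B p = cube_map s' B' p"
  shows "B = B'"
proof -
  have "p (opp 0) = opp (p 0)" using p zero_noncentral by (simp add: sym_perms_iff)
  then have "p 0 \<noteq> opp (p 0)"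
    using permutes_inj[OF sym_perms_permutes[OF p]] zero_noncentral by (metis injD)
  then have "i \<in> B \<longleftrightarrow> i \<in> B'" if "i \<in> coords" for i
    using cube_map_eq_imp_reflect_eq[OF s eq that zero_noncentral(1)]
    by (auto simp: reflect_def split: if_splits)
  then show ?thesis using B by blast
qed

lemma opp_in_sym_perms: "restrict_id opp {..<n} \<in> sym_perms n"
proof -
  have "bij_betw opp {..<n} {..<n}"
    using image_opp by (auto simp: bij_betw_def inj_on_def opp_eq_iff)
  then show ?thesis
    unfolding sym_perms_iff by (intro conjI permutes_restrict_id) (simp_all add: restrict_id_def)
qed

lemma cube_map_compl:
  assumes "s permutes coords" "p \<in> sym_perms n"
  shows "cube_map s (coords - B) (restrict_id opp {..<n} \<circ> p) = cube_map s B p"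
proof -
  have "p (x (s i)) < n" if "x \<in> points" "i \<in> coords" for x i
    using that points_less sym_perms_less[OF assms(2)] permutes_in_image[OF assms(1)] by blast
  then show ?thesis by (auto simp: cube_map_def reflect_def restrict_id_def fun_eq_iff)
qed

lemma order_coord_group:
  assumes "1 \<le> d"
  shows "order (coord_group n d) = card (sym_perms n)"
proof -
  have "coord_map n d p = cube_map id {} p" for p
    by (auto simp: coord_map_def cube_map_def reflect_def fun_eq_iff)
  then have "inj_on (coord_map n d) (sym_perms n)"
    using assms cube_map_eq_imp_value_permutation_eq[OF permutes_id permutes_id,
        where B = "{}" and B' = "{}" and i = 1]
    by (intro inj_onI) simp
  then show ?thesis by (simp add: order_def coord_group_def card_image)
qed

subsection \<open>The rotation group\<close>

abbreviation signed_perm :: "(nat \<Rightarrow> nat) \<Rightarrow> nat set \<Rightarrow> (nat \<Rightarrow> nat) \<Rightarrow> nat \<Rightarrow> nat" where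
  "signed_perm s B \<equiv> cube_map s B id"

definition even_signed_perms :: "((nat \<Rightarrow> nat) \<Rightarrow> nat \<Rightarrow> nat) set" where
  "even_signed_perms =
    {signed_perm s B | s B. s permutes coords \<and> B \<subseteq> coords \<and> even (card B) = evenperm s}"

lemma signed_perm_mult:
  assumes "s permutes coords" "s' permutes coords"
  shows "signed_perm s B \<otimes>\<^bsub>BijGroup points\<^esub> signed_perm s' B' =
    signed_perm (s' \<circ> s) (sym_diff B (s -` B'))"
  using compose_cube_map[OF assms id_in_sym_perms id_in_sym_perms]
    cube_map_in_Bij id_in_sym_perms assms by (simp add: BijGroup_def)

lemma signed_perm_id: "signed_perm id {} = \<one>\<^bsub>BijGroup points\<^esub>"
  by (auto simp: BijGroup_def cube_map_def reflect_def cube_def fun_eq_iff PiE_def extensional_def)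

lemma signed_perm_in_BijGroup: "s permutes coords \<Longrightarrow> signed_perm s B \<in> carrier (BijGroup points)"
  using cube_map_in_Bij id_in_sym_perms by (simp add: BijGroup_def)

lemma rot_eq_signed_perm:
  assumes ij: "i \<in> coords" "j \<in> coords" "i \<noteq> j"
  shows "rot n d i j = signed_perm (transpose i j) {i}"
proof
  fix x show "rot n d i j x = signed_perm (transpose i j) {i} x"
  proof (cases "x \<in> points")
    case True
    show ?thesis
    proof (rule points_eqI)
      show "rot n d i j x \<in> points"
        using rot_in_Bij[OF ij] True by (auto simp: Bij_def bij_betw_def)
      show "signed_perm (transpose i j) {i} x \<in> points"
        by (rule cube_map_in_points[OF permutes_swap_id[OF ij(1,2)] id_in_sym_perms True])
      show "rot n d i j x k = signed_perm (transpose i j) {i} x k" if "k \<in> coords" for k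
        using that True ij(3)
        by (auto simp: rot_def cube_map_apply reflect_def opp_def transpose_def)
    qed
  qed (simp add: rot_def cube_map_def)
qed

lemma even_signed_permsE:
  assumes "f \<in> even_signed_perms"
  obtains s B where "f = signed_perm s B" "s permutes coords" "B \<subseteq> coords"
    "even (card B) = evenperm s"
  using assms unfolding even_signed_perms_def by blast

lemma even_signed_perms_mult:
  assumes "f \<in> even_signed_perms" "g \<in> even_signed_perms"
  shows "f \<otimes>\<^bsub>BijGroup points\<^esub> g \<in> even_signed_perms"
proof -
  obtain s B where f: "f = signed_perm s B" "s permutes coords" "B \<subseteq> coords"
    "even (card B) = evenperm s" using assms(1) by (rule even_signed_permsE)
  obtain s' B' where g: "g = signed_perm s' B'" "s' permutes coords" "B' \<subseteq> coords"
    "even (card B') = evenperm s'" using assms(2) by (rule even_signed_permsE)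
  have subset: "s -` B' \<subseteq> coords" by (rule permutes_vimage_subset[OF f(2) g(3)])
  then have "finite B" "finite (s -` B')" using f(3) by (auto intro: finite_subset)
  moreover have "evenperm (s' \<circ> s) \<longleftrightarrow> evenperm s' = evenperm s"
    using f(2) g(2) by (intro evenperm_comp permutes_imp_permutation[OF finite_atLeastAtMost])
  ultimately have "even (card (sym_diff B (s -` B'))) = evenperm (s' \<circ> s)"
    using f(4) g(4) card_vimage_permutes[OF f(2)] by (simp add: even_card_sym_diff) blast
  moreover have "sym_diff B (s -` B') \<subseteq> coords" using f(3) subset by blast
  ultimately show ?thesis
    unfolding f(1) g(1) signed_perm_mult[OF f(2) g(2)] even_signed_perms_def
    using permutes_compose[OF f(2) g(2)] by blast
qed

lemma even_signed_perms_inv: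
  assumes "f \<in> even_signed_perms"
  shows "inv\<^bsub>BijGroup points\<^esub> f \<in> even_signed_perms"
proof -
  obtain s B where f: "f = signed_perm s B" "s permutes coords" "B \<subseteq> coords"
    "even (card B) = evenperm s" using assms by (rule even_signed_permsE)
  let ?s = "inv_into UNIV s"
  have s': "?s permutes coords" by (rule permutes_inv[OF f(2)])
  have "signed_perm ?s (?s -` B) \<otimes>\<^bsub>BijGroup points\<^esub> f = \<one>\<^bsub>BijGroup points\<^esub>"
    using signed_perm_mult[OF s' f(2)] permutes_inv_o(1)[OF f(2)] by (simp add: f(1) signed_perm_id)
  then have "inv\<^bsub>BijGroup points\<^esub> f = signed_perm ?s (?s -` B)"
    using signed_perm_in_BijGroup s' f(1,2) by (intro group.inv_equality[OF group_BijGroup]) auto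
  moreover have "evenperm ?s = evenperm s"
    using f(2) by (intro evenperm_inv permutes_imp_permutation[OF finite_atLeastAtMost])
  then have "even (card (?s -` B)) = evenperm ?s" using card_vimage_permutes[OF s'] f(4) by simp
  ultimately show ?thesis
    unfolding even_signed_perms_def using s' permutes_vimage_subset[OF s' f(3)] by blast
qed

lemma subgroup_even_signed_perms: "subgroup even_signed_perms (BijGroup points)"
proof
  show "even_signed_perms \<subseteq> carrier (BijGroup points)"
    using signed_perm_in_BijGroup by (auto simp: even_signed_perms_def)
  have "signed_perm id {} \<in> even_signed_perms"
    unfolding even_signed_perms_def using permutes_id evenperm_id by fastforce
  then show "\<one>\<^bsub>BijGroup points\<^esub> \<in> even_signed_perms" by (simp add: signed_perm_id)
qed (use even_signed_perms_mult even_signed_perms_inv in auto)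

lemma rot_group_mult:
  "f \<in> carrier (rot_group n d) \<Longrightarrow> g \<in> carrier (rot_group n d) \<Longrightarrow>
    f \<otimes>\<^bsub>BijGroup points\<^esub> g \<in> carrier (rot_group n d)"
  by (simp add: rot_group_def generate.eng)

lemma quarter_turn_in_rot_group:
  assumes "i \<in> coords" "j \<in> coords" "i \<noteq> j"
  shows "signed_perm (transpose i j) {i} \<in> carrier (rot_group n d)"
  unfolding rot_eq_signed_perm[OF assms, symmetric] rot_group_def
  using assms by (auto intro: generate.incl)

text \<open>The square of a quarter turn reflects the two coordinates involved.\<close>

lemma even_reflection_in_rot_group:
  assumes "B \<subseteq> coords" "even (card B)"
  shows "signed_perm id B \<in> carrier (rot_group n d)"
  using assms
proof (induction "card B" arbitrary: B rule: less_induct)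
  case less
  have finite: "finite B" using less.prems(1) by (rule finite_subset) simp
  show ?case
  proof (cases "B = {}")
    case True
    then show ?thesis by (simp add: rot_group_def signed_perm_id generate.one)
  next
    case False
    then have "1 < card B"
      using finite less.prems(2) by (metis card_0_eq less_one linorder_neqE_nat odd_one)
    then obtain i j where ij: "i \<in> B" "j \<in> B" "i \<noteq> j"
      by (metis card_le_Suc0_iff_eq finite One_nat_def leD)
    then have coords: "i \<in> coords" "j \<in> coords" using less.prems(1) by auto
    have swap: "transpose i j permutes coords" by (rule permutes_swap_id[OF coords])
    have "sym_diff {i} (transpose i j -` {i}) = {i, j}"
      using ij(3) by (auto simp: transpose_def split: if_splits)
    then have "signed_perm id {i, j} \<in> carrier (rot_group n d)"
      using quarter_turn_in_rot_group[OF coords ij(3)] rot_group_mult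
        signed_perm_mult[OF swap swap, of "{i}" "{i}"] by fastforce
    moreover have "card (B - {i, j}) = card B - 2" using ij finite by (simp add: card_Diff_subset)
    then have "signed_perm id (B - {i, j}) \<in> carrier (rot_group n d)"
      using less.hyps[of "B - {i, j}"] less.prems \<open>1 < card B\<close> by auto
    ultimately have "signed_perm id (sym_diff {i, j} (B - {i, j})) \<in> carrier (rot_group n d)"
      using rot_group_mult signed_perm_mult[OF permutes_id permutes_id, of "{i, j}" "B - {i, j}"]
      by fastforce
    moreover have "sym_diff {i, j} (B - {i, j}) = B" using ij by blast
    ultimately show ?thesis by simp
  qed
qed

lemma even_signed_perm_in_rot_group:
  assumes "s permutes coords" "B \<subseteq> coords" "even (card B) = evenperm s"
  shows "signed_perm s B \<in> carrier (rot_group n d)"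
  using assms(1) finite_atLeastAtMost assms(2,3)
proof (induction arbitrary: B rule: permutes_induct)
  case id
  show ?case by (rule even_reflection_in_rot_group) (use id in simp_all)
next
  case (swap a b s)
  let ?B = "sym_diff B (s -` {a})"
  have p: "transpose a b permutes coords" by (rule permutes_swap_id[OF swap.hyps(1,2)])
  have vimage: "s -` {a} \<subseteq> coords" "card (s -` {a}) = 1"
    using permutes_vimage_subset[OF swap.hyps(4)] swap.hyps(1) card_vimage_permutes[OF swap.hyps(4)]
    by auto
  then have B: "?B \<subseteq> coords" "finite B" "finite (s -` {a})"
    using swap.prems(1) finite_subset[OF _ finite_atLeastAtMost] by blast+
  have "evenperm (transpose a b \<circ> s) \<longleftrightarrow> \<not> evenperm s"
    using swap.hyps(3,4) p
    by (simp add: evenperm_comp evenperm_swap permutes_imp_permutation[of coords])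
  then have "even (card ?B) = evenperm s"
    using even_card_sym_diff[OF B(2,3)] swap.prems(2) vimage(2) odd_one by metis
  then have "signed_perm s ?B \<otimes>\<^bsub>BijGroup points\<^esub> signed_perm (transpose a b) {a}
      \<in> carrier (rot_group n d)"
    using rot_group_mult swap.IH[OF B(1)] quarter_turn_in_rot_group[OF swap.hyps(1-3)] by blast
  moreover have "sym_diff ?B (s -` {a}) = B" by blast
  ultimately show ?case by (simp only: signed_perm_mult[OF swap.hyps(4) p])
qed

theorem carrier_rot_group: "carrier (rot_group n d) = even_signed_perms"
proof
  have "rot n d i j \<in> even_signed_perms" if "i \<in> coords" "j \<in> coords" "i \<noteq> j" for i j
    unfolding even_signed_perms_def using that permutes_swap_id[OF that(1,2)]
    by (auto simp: rot_eq_signed_perm evenperm_swap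
        intro!: exI[of _ "transpose i j"] exI[of _ "{i}"])
  then have "{rot n d i j | i j. i \<in> coords \<and> j \<in> coords \<and> i \<noteq> j} \<subseteq> even_signed_perms" by blast
  from group.generate_subgroup_incl[OF group_BijGroup this subgroup_even_signed_perms]
  show "carrier (rot_group n d) \<subseteq> even_signed_perms" by (simp add: rot_group_def)
  show "even_signed_perms \<subseteq> carrier (rot_group n d)"
    using even_signed_perm_in_rot_group by (auto simp: even_signed_perms_def)
qed

theorem order_rot_group:
  assumes "1 \<le> d"
  shows "order (rot_group n d) = fact d * 2 ^ (d - 1)"
proof -
  let ?P = "SIGMA s:{s. s permutes coords}. {B. B \<subseteq> coords \<and> even (card B) = evenperm s}"
  let ?f = "\<lambda>(s, B). signed_perm s B"
  have "inj_on ?f ?P"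
  proof (rule inj_onI, clarify)
    fix s B s' B' assume s: "s permutes coords" "s' permutes coords"
      and B: "B \<subseteq> coords" "B' \<subseteq> coords"
      and eq: "signed_perm s B = signed_perm s' B'"
    show "s = s' \<and> B = B'"
      using cube_map_eq_imp_permutation_eq[OF s id_in_sym_perms eq]
        cube_map_eq_imp_reflections_eq[OF s id_in_sym_perms B eq] by simp
  qed
  moreover have "?f ` ?P = even_signed_perms" by (force simp: even_signed_perms_def)
  ultimately have "order (rot_group n d) = card ?P"
    using card_image[of ?f ?P] by (simp add: order_def carrier_rot_group)
  also have "\<dots> = (\<Sum>s | s permutes coords. card {B. B \<subseteq> coords \<and> even (card B) = evenperm s})"
    by (rule card_SigmaI) (simp_all add: finite_permutations)
  also have "\<dots> = (\<Sum>s | s permutes coords. 2 ^ (d - 1))"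
    using card_subsets_of_parity[of coords] assms by simp
  also have "\<dots> = fact d * 2 ^ (d - 1)" by (simp add: card_permutations)
  finally show ?thesis .
qed

end

locale tictactoe_cube = cube_lines +
  assumes three_le_n: "3 \<le> n" and two_le_d: "2 \<le> d"
begin

section \<open>Main diagonals are preserved\<close>

declare One_nat_def [simp del]

lemma one_two_in_coords: "1 \<in> coords" "2 \<in> coords"
  using two_le_d by auto

lemma line_main_diagonal: "line (main_diagonal A)"
  using line_param_line[of "diag_point A 0" coords A] param_line_coords[of "diag_point A 0" A]
    one_two_in_coords zero_noncentral by auto

lemma diag_point_eq_iff:
  assumes "A \<subseteq> coords" "B \<subseteq> coords" "s < n" "t < n" "t \<noteq> opp t"
  shows "diag_point A s = diag_point B t \<longleftrightarrow> A = B \<and> s = t \<or> A = coords - B \<and> s = opp t"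
proof
  assume eq: "diag_point A s = diag_point B t"
  have reflect_eq: "reflect A i s = reflect B i t" if "i \<in> coords" for i
    using fun_cong[OF eq, of i] that by (simp add: diag_point_apply)
  from reflect_eq[OF one_two_in_coords(1)] consider (same) "s = t" | (opposite) "s = opp t"
    using assms(3,4) by (auto simp: reflect_def opp_eq_iff split: if_splits)
  then show "A = B \<and> s = t \<or> A = coords - B \<and> s = opp t"
  proof cases
    case same
    then have "i \<in> A \<longleftrightarrow> i \<in> B" if "i \<in> coords" for i
      using reflect_eq[OF that] assms(5) by (auto simp: reflect_def split: if_splits)
    then show ?thesis using same assms(1,2) by blast
  next
    case opposite
    then have "i \<in> A \<longleftrightarrow> i \<notin> B" if "i \<in> coords" for i
      using reflect_eq[OF that] assms(4,5) by (auto simp: reflect_def split: if_splits)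
    then show ?thesis using opposite assms(1,2) by blast
  qed
next
  assume "A = B \<and> s = t \<or> A = coords - B \<and> s = opp t"
  then show "diag_point A s = diag_point B t" using assms diag_point_compl[of "opp t" B] by auto
qed

lemma diagonal_points_iff:
  "P \<in> diagonal_points \<longleftrightarrow> P \<in> points \<and> (\<forall>i\<in>coords. \<forall>j\<in>coords. P i = P j \<or> P i = opp (P j))"
proof (intro iffI conjI)
  assume P: "P \<in> points \<and> (\<forall>i\<in>coords. \<forall>j\<in>coords. P i = P j \<or> P i = opp (P j))"
  then have P1: "P 1 < n" using points_less one_two_in_coords by blast
  have "P = diag_point {i \<in> coords. P i \<noteq> P 1} (P 1)"
  proof (rule points_eqI)
    fix i assume i: "i \<in> coords"
    then have "P i = P 1 \<or> P i = opp (P 1)" using P one_two_in_coords(1) by blast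
    then show "P i = diag_point {i \<in> coords. P i \<noteq> P 1} (P 1) i"
      using i by (auto simp: diag_point_apply reflect_def)
  qed (use P P1 in auto)
  then show "P \<in> diagonal_points" unfolding diagonal_points_def using P1 by blast
qed (auto simp: diagonal_points_def diag_point_apply reflect_def)

lemma noncentral_diagonal_points_iff:
  "P \<in> noncentral_diagonal_points \<longleftrightarrow> P \<in> diagonal_points \<and> P 1 \<noteq> opp (P 1)"
proof -
  have "diag_point A t 1 \<noteq> opp (diag_point A t 1) \<longleftrightarrow> t \<noteq> opp t" if "t < n" for A t
    using that one_two_in_coords(1) by (auto simp: diag_point_apply reflect_def)
  then show ?thesis unfolding noncentral_diagonal_points_def diagonal_points_def by blast
qed

lemma line_subset_diagonal_points:
  assumes L: "line L" "L \<subseteq> diagonal_points"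
  obtains A where "A \<subseteq> coords" "L = main_diagonal A"
proof -
  obtain x S A where x: "x \<in> points" "S \<subseteq> coords" "S \<noteq> {}" and L_eq: "L = param_line x S A"
    using L(1) by (rule lineE)
  have "S = coords"
  proof (rule ccontr)
    assume "S \<noteq> coords"
    then obtain i j where ij: "i \<in> coords" "i \<notin> S" "j \<in> S" "j \<in> coords" using x by blast
    have "x i = reflect A j t \<or> x i = opp (reflect A j t)" if "t < n" for t
    proof -
      have "line_point x S A t \<in> diagonal_points"
        using L(2) L_eq line_point_in_param_line[OF that] by blast
      then have "line_point x S A t i = line_point x S A t j \<or>
          line_point x S A t i = opp (line_point x S A t j)"
        using ij unfolding diagonal_points_iff by blast
      then show ?thesis using ij by (simp add: line_point_def)
    qed
    from this[of 0] this[of 1] show False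
      using three_le_n by (auto simp: reflect_def opp_def split: if_splits)
  qed
  then have "L = main_diagonal A" using L_eq param_line_coords[OF x(1)] by simp
  also have "diag_point A = diag_point (A \<inter> coords)"
    by (intro ext restrict_ext) (simp add: diag_point_def reflect_def)
  then have "main_diagonal A = main_diagonal (A \<inter> coords)" by (simp add: main_diagonal_def)
  finally show thesis using that[of "A \<inter> coords"] by blast
qed

subsection \<open>The noncentral points of the main diagonals never have 0 or 2 transversals\<close>

lemma card_transversals_comparable:
  assumes a: "a < n" "a \<noteq> opp a" and ST: "S \<subset> T" "T \<subseteq> coords" "S \<noteq> {}"
  shows "3 \<le> card (transversals (diag_point A a) (pencil_line A a S) (pencil_line A a T))"
proof -
  let ?U = "{(s, t). s \<in> {..<n} - {a} \<and> t \<in> {..<n} - {a} \<and>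
    collinear (pencil_point A a S s) (pencil_point A a T t)}"
  have fin: "finite ?U" by (rule finite_subset[of _ "{..<n} \<times> {..<n}"]) auto
  have equal: "(s, s) \<in> ?U" if "s < n" "s \<noteq> a" for s
    using that a ST by (auto intro!: collinear_pencil_points)
  have "3 \<le> card ?U"
  proof (cases "n = 3")
    case True \<comment> \<open>equal parameters give only two pairs here, but the central value yields a third\<close>
    then have one: "1 < n" "1 \<noteq> a" "1 \<noteq> opp a" "1 = opp 1" using a unfolding opp_def by auto
    then have "(opp a, 1) \<in> ?U" using a ST by (auto intro!: collinear_pencil_points_central)
    then have "{(1, 1), (opp a, opp a), (opp a, 1)} \<subseteq> ?U" using equal one a by auto
    from card_mono[OF fin this] show ?thesis using one(3) by auto
  next
    case False
    have "card ({..<n} - {a}) = card ((\<lambda>s. (s, s)) ` ({..<n} - {a}))"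
      by (rule card_image[symmetric]) (auto simp: inj_on_def)
    also have "\<dots> \<le> card ?U" by (rule card_mono[OF fin]) (use equal in auto)
    finally show ?thesis using False three_le_n a by simp
  qed
  then show ?thesis using card_transversals_pencil_lines[of a S T A] a ST by auto
qed

lemma noncentral_imp_never_0_2_transversals:
  assumes "P \<in> noncentral_diagonal_points"
  shows "never_0_2_transversals P"
proof -
  obtain A a where P: "P = diag_point A a" and a: "a < n" "a \<noteq> opp a"
    using assms by (auto simp: noncentral_diagonal_points_def)
  show ?thesis unfolding never_0_2_transversals_def P
  proof (intro allI impI)
    fix L M assume LM: "line L" "line M" "diag_point A a \<in> L" "diag_point A a \<in> M" "L \<noteq> M"
    obtain S where S: "S \<subseteq> coords" "S \<noteq> {}" "L = pencil_line A a S"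
      using line_through_diag_point[OF LM(1,3) a] .
    obtain T where T: "T \<subseteq> coords" "T \<noteq> {}" "M = pencil_line A a T"
      using line_through_diag_point[OF LM(2,4) a] .
    consider (less) "S \<subset> T" | (greater) "T \<subset> S" | (incomparable) "\<not> comparable S T"
      using LM(5) S(3) T(3) by blast
    then show "card (transversals (diag_point A a) L M) \<notin> {0, 2}"
    proof cases
      case less
      from card_transversals_comparable[OF a less T(1) S(2), of A] show ?thesis
        using S(3) T(3) by auto
    next
      case greater
      from card_transversals_comparable[OF a greater S(1) T(2), of A] show ?thesis
        using card_transversals_commute S(3) T(3) by fastforce
    next
      case incomparable
      from card_transversals_incomparable[OF a S(1) T(1) incomparable, of A] show ?thesis
        using S(3) T(3) by simp
    qed
  qed
qed

lemma never_0_2_transversals_imp_noncentral: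
  assumes P: "P \<in> points" "never_0_2_transversals P"
  shows "P \<in> noncentral_diagonal_points"
proof (rule ccontr)
  assume not_noncentral: "P \<notin> noncentral_diagonal_points"
  have regular: "card ({(P j, P i), (opp (P j), opp (P i))} - {(P i, P j)}) \<notin> {0, 2}"
    if "i \<in> coords" "j \<in> coords" "i \<noteq> j" for i j
    using P that card_transversals_axis_lines line_axis_line base_in_axis_line axis_lines_neq
    unfolding never_0_2_transversals_def by metis
  show False
  proof (cases "P \<in> diagonal_points")
    case True
    then have central: "P 1 = opp (P 1)"
      using not_noncentral noncentral_diagonal_points_iff by blast
    then have "P 2 = P 1"
      using True one_two_in_coords unfolding diagonal_points_iff by metis
    then show False using regular[OF one_two_in_coords] central by simp
  next
    case False
    then obtain i j where ij: "i \<in> coords" "j \<in> coords" "P i \<noteq> P j" "P i \<noteq> opp (P j)"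
      using P(1) diagonal_points_iff by blast
    have less: "P i < n" "P j < n" using points_less[OF P(1)] ij by auto
    have "(P j, P i) \<noteq> (opp (P j), opp (P i))" using central_unique[OF less] ij(3) by auto
    moreover have "(P j, P i) \<noteq> (P i, P j)" "(opp (P j), opp (P i)) \<noteq> (P i, P j)" using ij by auto
    ultimately have "card ({(P j, P i), (opp (P j), opp (P i))} - {(P i, P j)}) = 2"
      by (simp add: insert_Diff_if)
    then show False using regular[of i j] ij by auto
  qed
qed

subsection \<open>Line-preserving bijections permute the main diagonals\<close>

lemma noncentral_line_auts_iff:
  assumes f: "f \<in> line_auts" and P: "P \<in> points"
  shows "f P \<in> noncentral_diagonal_points \<longleftrightarrow> P \<in> noncentral_diagonal_points"
proof -
  have never_iff: "never_0_2_transversals Q \<longleftrightarrow> Q \<in> noncentral_diagonal_points" if "Q \<in> points" for Q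
    using that noncentral_imp_never_0_2_transversals never_0_2_transversals_imp_noncentral by blast
  have fP: "f P \<in> points" using line_auts_in_points[OF f P] .
  obtain g where g: "g \<in> line_auts" "g (f P) = P" using line_auts_inverse[OF f] P by metis
  have "never_0_2_transversals (f P) \<longleftrightarrow> never_0_2_transversals P"
    using never_0_2_transversals_line_auts[OF f P]
      never_0_2_transversals_line_auts[OF g(1) fP] g(2) by auto
  then show ?thesis using never_iff P fP by simp
qed

lemma diagonal_points_iff_collinear:
  assumes P: "P \<in> points"
  shows "P \<in> diagonal_points \<longleftrightarrow>
    P \<in> noncentral_diagonal_points \<or> (\<forall>Q\<in>noncentral_diagonal_points. collinear P Q)"
proof
  assume P_diag: "P \<in> diagonal_points"
  show "P \<in> noncentral_diagonal_points \<or> (\<forall>Q\<in>noncentral_diagonal_points. collinear P Q)"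
  proof (cases "P 1 = opp (P 1)")
    case central: True
    have P_const: "P i = P 1" if "i \<in> coords" for i
      using P_diag that central one_two_in_coords(1) unfolding diagonal_points_iff by metis
    have "collinear P Q" if "Q \<in> noncentral_diagonal_points" for Q
    proof (rule collinearI[OF P])
      have Q: "Q \<in> diagonal_points" using that noncentral_subset_diagonal_points by blast
      then show "Q \<in> points" using diagonal_points_iff by blast
      fix i j assume ij: "i \<in> coords" "j \<in> coords"
      then have "Q i = Q j \<or> Q i = opp (Q j)" using Q diagonal_points_iff by blast
      moreover have "P i = P j" "P i = opp (P j)" using P_const ij central by metis+
      ultimately show "P i = P j \<and> Q i = Q j \<or> P i = opp (P j) \<and> Q i = opp (Q j)" by argo
    qed
    then show ?thesis by blast
  qed (use P_diag noncentral_diagonal_points_iff in blast)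
next
  assume coll: "P \<in> noncentral_diagonal_points \<or> (\<forall>Q\<in>noncentral_diagonal_points. collinear P Q)"
  show "P \<in> diagonal_points"
  proof (rule ccontr)
    assume not_diag: "P \<notin> diagonal_points"
    then obtain i j where ij: "i \<in> coords" "j \<in> coords" "P i \<noteq> P j" "P i \<noteq> opp (P j)"
      using P diagonal_points_iff by blast
    define A where "A = {k \<in> coords. P k = 0}"
    have "diag_point A 0 \<in> noncentral_diagonal_points"
      unfolding noncentral_diagonal_points_def A_def using zero_noncentral by blast
    then have "collinear P (diag_point A 0)"
      using coll not_diag noncentral_subset_diagonal_points by blast
    moreover have "P k \<noteq> diag_point A 0 k" if "k \<in> coords" for k
      using that zero_noncentral by (auto simp: diag_point_apply reflect_def A_def)
    ultimately show False using collinearD[of P _ i j] ij by blast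
  qed
qed

lemma diagonal_points_line_auts:
  assumes f: "f \<in> line_auts" and P: "P \<in> diagonal_points"
  shows "f P \<in> diagonal_points"
proof (cases "P \<in> noncentral_diagonal_points")
  case True
  then show ?thesis
    using noncentral_line_auts_iff[OF f] noncentral_diagonal_points_subset_points
      noncentral_subset_diagonal_points
    by blast
next
  case False
  have P_points: "P \<in> points" using P diagonal_points_iff by blast
  have "collinear (f P) Q" if Q: "Q \<in> noncentral_diagonal_points" for Q
  proof -
    obtain g where g: "g \<in> line_auts" "\<And>x. x \<in> points \<Longrightarrow> f (g x) = x"
      using line_auts_inverse[OF f] by metis
    have "Q \<in> points" using Q noncentral_diagonal_points_subset_points by blast
    then have gQ: "g Q \<in> points" "f (g Q) = Q" using g line_auts_in_points by auto
    then have "g Q \<in> noncentral_diagonal_points" using Q noncentral_line_auts_iff[OF f] by metis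
    then have "collinear P (g Q)" using P False diagonal_points_iff_collinear[OF P_points] by blast
    then show ?thesis using collinear_line_auts_iff[OF f P_points gQ(1)] gQ(2) by simp
  qed
  then show ?thesis using diagonal_points_iff_collinear line_auts_in_points[OF f P_points] by blast
qed

lemma main_diagonal_line_auts:
  assumes "f \<in> line_auts" "A \<subseteq> coords"
  obtains B where "B \<subseteq> coords" "f ` main_diagonal A = main_diagonal B"
proof -
  have "main_diagonal A \<subseteq> diagonal_points"
    using assms(2) unfolding main_diagonal_def diagonal_points_def by blast
  then have "f ` main_diagonal A \<subseteq> diagonal_points"
    using diagonal_points_line_auts[OF assms(1)] by blast
  then show thesis
    using line_subset_diagonal_points[OF line_auts_line[OF assms(1) line_main_diagonal]] that
    by metis
qed

lemma diag_point_inject: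
  assumes "s < n" "t < n"
  shows "diag_point A s = diag_point A t \<longleftrightarrow> s = t"
proof
  assume "diag_point A s = diag_point A t"
  from fun_cong[OF this, of 1] show "s = t"
    using one_two_in_coords(1) assms
    by (simp add: diag_point_apply reflect_eq_iff del: atLeastAtMost_iff)
qed simp

lemma bij_betw_diag_point: "bij_betw (diag_point A) {..<n} (main_diagonal A)"
  by (simp add: bij_betw_def inj_on_def diag_point_inject main_diagonal_def)

lemma diag_point_noncentral_iff:
  assumes "t < n"
  shows "diag_point A t \<in> noncentral_diagonal_points \<longleftrightarrow> t \<noteq> opp t"
proof -
  have "diag_point A t \<in> diagonal_points"
    using assms by (auto simp: diagonal_points_iff diag_point_apply reflect_def)
  then show ?thesis
    using assms one_two_in_coords(1)
    by (auto simp: noncentral_diagonal_points_iff diag_point_apply reflect_def)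
qed

lemma diag_point_off_main_diagonal_line_auts:
  assumes f: "f \<in> line_auts"
    and AB: "A \<subseteq> coords" "B \<subseteq> coords" "f ` main_diagonal A = main_diagonal B"
    and A': "A' \<subseteq> coords" "A' \<noteq> A" "A' \<noteq> coords - A" and t: "t < n" "t \<noteq> opp t"
  obtains B' w where "B' \<subseteq> coords" "B \<noteq> B'" "B \<noteq> coords - B'"
    "w < n" "w \<noteq> opp w" "f (diag_point A' t) = diag_point B' w"
proof -
  have "f (diag_point A' t) \<in> noncentral_diagonal_points"
    using noncentral_line_auts_iff[OF f] diag_point_noncentral_iff t by simp
  then obtain B' w where B': "B' \<subseteq> coords"
    and w: "w < n" "w \<noteq> opp w" "f (diag_point A' t) = diag_point B' w"
    by (auto simp: noncentral_diagonal_points_def)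
  have "diag_point A' t \<notin> main_diagonal A"
    unfolding main_diagonal_def
    using diag_point_eq_iff[OF AB(1) A'(1) _ t] A' AB(1) by (auto dest: sym)
  then have "diag_point B' w \<notin> main_diagonal B"
    using line_auts_image_mem_iff[OF f main_diagonal_subset_points[of A], of "diag_point A' t"]
      AB(3) t(1) w(3) by simp
  moreover have "diag_point B' w \<in> main_diagonal B'"
    unfolding main_diagonal_def using w(1) by blast
  moreover have "diag_point B' w = diag_point (coords - B') (opp w)"
    using w(1) diag_point_compl[of "opp w" B'] by simp
  then have "diag_point B' w \<in> main_diagonal (coords - B')"
    unfolding main_diagonal_def by simp
  ultimately have "B \<noteq> B'" "B \<noteq> coords - B'" by auto
  then show thesis using that B' w by blast
qed

lemma line_auts_preserve_opposition:
  assumes f: "f \<in> line_auts"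
    and AB: "A \<subseteq> coords" "B \<subseteq> coords" "f ` main_diagonal A = main_diagonal B"
    and t: "t < n" "t \<noteq> opp t" and uv: "u < n" "v < n"
    and image: "f (diag_point A t) = diag_point B u" "f (diag_point A (opp t)) = diag_point B v"
  shows "v = opp u"
proof -
  define A' where "A' = sym_diff A {1}"
  have "1 \<in> A' \<longleftrightarrow> 1 \<notin> A" "2 \<in> A' \<longleftrightarrow> 2 \<in> A" by (auto simp: A'_def)
  then have A': "A' \<subseteq> coords" "A' \<noteq> A" "A' \<noteq> coords - A"
    using AB(1) one_two_in_coords unfolding A'_def by blast+
  obtain B' w where B': "B' \<subseteq> coords" and off_B: "B \<noteq> B'" "B \<noteq> coords - B'"
    and w: "w < n" "w \<noteq> opp w" "f (diag_point A' t) = diag_point B' w"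
    using diag_point_off_main_diagonal_line_auts[OF f AB A' t] .
  have level: "w = x \<or> w = opp x"
    if "x < n" "f (diag_point A s) = diag_point B x" "s = t \<or> s = opp t" for s x
  proof (rule collinear_diag_points_imp_same_level[OF AB(2) B' off_B that(1) w(1)])
    have s: "s < n" "s \<noteq> opp s" using t that(3) by auto
    then show "x \<noteq> opp x"
      using noncentral_line_auts_iff[OF f, of "diag_point A s"] diag_point_noncentral_iff that(1,2)
      by simp
    have "collinear (diag_point A s) (diag_point A' t)"
      by (rule collinear_diag_points) (use s t that(3) in auto)
    then show "collinear (diag_point B x) (diag_point B' w)"
      using collinear_line_auts_iff[OF f] s t w(3) that(2) by (metis diag_point_in_points)
  qed (rule w(2))
  have "diag_point A t \<noteq> diag_point A (opp t)"
    using diag_point_inject[of t "opp t" A] t by simp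
  then have "u \<noteq> v" using image line_auts_eq_iff[OF f] t(1) by (metis diag_point_in_points opp_less)
  then show ?thesis using level[OF uv(1) image(1)] level[OF uv(2) image(2)] uv by (metis opp_opp)
qed

lemma diag_point_line_auts:
  assumes f: "f \<in> line_auts" and A: "A \<subseteq> coords"
  obtains B p where "B \<subseteq> coords" "p \<in> sym_perms n"
    "\<And>t. t < n \<Longrightarrow> f (diag_point A t) = diag_point B (p t)"
proof -
  obtain B where B: "B \<subseteq> coords" "f ` main_diagonal A = main_diagonal B"
    using main_diagonal_line_auts[OF f A] .
  have "bij_betw f (main_diagonal A) (main_diagonal B)"
    using line_auts_inj_on[OF f] main_diagonal_subset_points B(2)
    by (auto simp: bij_betw_def inj_on_subset)
  then have "bij_betw (f \<circ> diag_point A) {..<n} (main_diagonal B)"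
    by (rule bij_betw_trans[OF bij_betw_diag_point])
  then obtain p where p: "p permutes {..<n}"
    and image_on: "\<And>t. t \<in> {..<n} \<Longrightarrow> (f \<circ> diag_point A) t = diag_point B (p t)"
    using bij_betw_diag_point by (rule bij_betw_factor_permutes) blast
  then have image: "f (diag_point A t) = diag_point B (p t)" if "t < n" for t using that by simp
  have less: "p t < n" if "t < n" for t using permutes_in_image[OF p] that by simp
  have "p (opp t) = opp (p t)" if t: "t < n" for t
  proof (cases "t = opp t")
    case True
    then have "p t = opp (p t)"
      using noncentral_line_auts_iff[OF f] diag_point_noncentral_iff diag_point_in_points
        image less t by metis
    then show ?thesis using True by metis
  next
    case False
    show ?thesis
      by (rule line_auts_preserve_opposition[OF f A B t False])
         (use less image t in auto)
  qed
  then show thesis using that[OF B(1) _ image] p by (simp add: sym_perms_iff)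
qed

section \<open>The action on the corners\<close>

abbreviation corner :: "nat set \<Rightarrow> nat \<Rightarrow> nat" where
  "corner A \<equiv> diag_point A 0"

definition fixes_base_diagonal :: "((nat \<Rightarrow> nat) \<Rightarrow> nat \<Rightarrow> nat) \<Rightarrow> bool" where
  "fixes_base_diagonal g \<longleftrightarrow> (\<forall>t<n. g (diag_point {} t) = diag_point {} t)"

text \<open>For corners, this expresses in terms of lines alone that the sets of coordinates in which \<open>Q\<close>
  and \<open>R\<close> differ from \<open>P\<close> are comparable.\<close>

definition inner_transversal :: "(nat \<Rightarrow> nat) \<Rightarrow> (nat \<Rightarrow> nat) \<Rightarrow> (nat \<Rightarrow> nat) \<Rightarrow> bool" where
  "inner_transversal P Q R \<longleftrightarrow>
    (\<exists>X\<in>line_through P Q - {P, Q}. \<exists>Y\<in>line_through P R - {P, R}. collinear X Y)"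

lemma inner_transversal_line_auts_iff:
  assumes f: "f \<in> line_auts" and PQR: "P \<in> points" "Q \<in> points" "R \<in> points"
  shows "inner_transversal (f P) (f Q) (f R) \<longleftrightarrow> inner_transversal P Q R"
proof -
  have image: "line_through (f P) (f S) - {f P, f S} = f ` (line_through P S - {P, S})"
    if "S \<in> points" for S
    using line_through_line_auts[OF f PQR(1) that] line_through_subset_points[of P S]
      line_auts_eq_iff[OF f] PQR(1) that by auto
  have "collinear (f X) (f Y) \<longleftrightarrow> collinear X Y"
    if "X \<in> line_through P Q - {P, Q}" "Y \<in> line_through P R - {P, R}" for X Y
  proof -
    have "X \<in> points" "Y \<in> points" using that line_through_subset_points by blast+
    then show ?thesis by (rule collinear_line_auts_iff[OF f])
  qed
  then show ?thesis
    unfolding inner_transversal_def image[OF PQR(2)] image[OF PQR(3)] bex_simps(7) by blast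
qed

lemma corner_in_points: "corner A \<in> points"
  using zero_noncentral by simp

lemma corner_eq_iff: "A \<subseteq> coords \<Longrightarrow> B \<subseteq> coords \<Longrightarrow> corner A = corner B \<longleftrightarrow> A = B"
  using diag_point_eq_iff[of A B 0 0] zero_noncentral by auto

lemma line_through_corners:
  assumes "A \<subseteq> coords" "B \<subseteq> coords" "A \<noteq> B"
  shows "line_through (corner A) (corner B) = pencil_line A 0 (sym_diff A B)"
proof (rule line_through_eq)
  let ?S = "sym_diff A B"
  have S: "?S \<subseteq> coords" "?S \<noteq> {}" "sym_diff A ?S = B" using assms by auto
  show "line (pencil_line A 0 ?S)" by (rule line_pencil_line[OF S(1,2) zero_noncentral(1)])
  show "corner A \<in> pencil_line A 0 ?S" "corner B \<in> pencil_line A 0 ?S"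
    using diag_points_in_pencil_line[OF S(1) zero_noncentral(1), of A] unfolding S(3) by auto
  show "corner A \<noteq> corner B" using corner_eq_iff assms by blast
qed

lemma pencil_point_between_corners_iff:
  assumes s: "s < n" and AB: "A \<subseteq> coords" "B \<subseteq> coords" "A \<noteq> B"
  shows "pencil_point A 0 (sym_diff A B) s \<in>
    pencil_line A 0 (sym_diff A B) - {corner A, corner B} \<longleftrightarrow> s \<noteq> 0 \<and> s \<noteq> opp 0"
proof -
  let ?S = "sym_diff A B"
  have S: "?S \<subseteq> coords" "sym_diff A ?S = B" using AB by auto
  obtain i where "i \<in> ?S" using AB(3) by blast
  then have "pencil_point A 0 ?S s = corner A \<longleftrightarrow> s = 0"
    "pencil_point A 0 ?S s = corner B \<longleftrightarrow> s = opp 0"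
    using line_point_eq_iff[of i ?S s _ "corner A" A] s zero_noncentral(1)
      pencil_point_base[OF S(1), of A 0] pencil_point_opp[OF S(1) zero_noncentral(1), of A]
    unfolding S(2) by (metis opp_less)+
  then show ?thesis using line_point_in_param_line[OF s] by auto
qed

lemma inner_transversal_corners_iff:
  assumes ABD: "A \<subseteq> coords" "B \<subseteq> coords" "D \<subseteq> coords" "A \<noteq> B" "A \<noteq> D"
  shows "inner_transversal (corner A) (corner B) (corner D) \<longleftrightarrow>
    comparable (sym_diff A B) (sym_diff A D)"
proof -
  let ?inner = "\<lambda>E. pencil_line A 0 (sym_diff A E) - {corner A, corner E}"
  note inner_iff = pencil_point_between_corners_iff[OF _ ABD(1)]
  have S: "sym_diff A B \<subseteq> coords" "sym_diff A D \<subseteq> coords" using ABD by auto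
  show ?thesis
    unfolding inner_transversal_def line_through_corners[OF ABD(1,2,4)]
      line_through_corners[OF ABD(1,3,5)]
  proof
    assume "comparable (sym_diff A B) (sym_diff A D)"
    then have "collinear (pencil_point A 0 (sym_diff A B) 1) (pencil_point A 0 (sym_diff A D) 1)"
      using three_le_n S by (intro collinear_pencil_points) auto
    moreover have "1 < n" "1 \<noteq> (0 :: nat)" "1 \<noteq> opp 0" using three_le_n by (auto simp: opp_def)
    ultimately show "\<exists>X\<in>?inner B. \<exists>Y\<in>?inner D. collinear X Y"
      using inner_iff[of 1 B] inner_iff[of 1 D] ABD by blast
  next
    assume "\<exists>X\<in>?inner B. \<exists>Y\<in>?inner D. collinear X Y"
    then obtain s t where st: "s < n" "t < n"
      "pencil_point A 0 (sym_diff A B) s \<in> ?inner B" "pencil_point A 0 (sym_diff A D) t \<in> ?inner D"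
      and coll: "collinear (pencil_point A 0 (sym_diff A B) s) (pencil_point A 0 (sym_diff A D) t)"
      unfolding param_line_def by blast
    then have "s \<noteq> 0" "s \<noteq> opp 0" "t \<noteq> 0" using inner_iff ABD by blast+
    then show "comparable (sym_diff A B) (sym_diff A D)"
      using collinear_pencil_points_incomparable[OF zero_noncentral st(1,2) _ _ S _ coll] by blast
  qed
qed

lemma corner_line_auts:
  assumes g: "g \<in> line_auts" "fixes_base_diagonal g" and A: "A \<subseteq> coords"
  shows "\<exists>B\<subseteq>coords. g (corner A) = corner B"
proof (cases "A = {} \<or> A = coords")
  case True
  have "corner coords = diag_point {} (opp 0)"
    using diag_point_compl[of 0 "{}"] zero_noncentral by simp
  then show ?thesis using True g(2) zero_noncentral by (auto simp: fixes_base_diagonal_def)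
next
  case False
  have "g (corner A) \<in> noncentral_diagonal_points"
    using noncentral_line_auts_iff[OF g(1) corner_in_points] diag_point_noncentral_iff
      zero_noncentral by blast
  then obtain B u where B: "B \<subseteq> coords" "u < n" "u \<noteq> opp u"
    and image: "g (corner A) = diag_point B u"
    by (auto simp: noncentral_diagonal_points_def)
  have off_diagonal: "diag_point B u \<noteq> diag_point {} t" if t: "t < n" for t
  proof
    assume "diag_point B u = diag_point {} t"
    then have "diag_point {} t = corner A"
      using g(2) image line_auts_eq_iff[OF g(1) corner_in_points] t
      by (metis diag_point_in_points fixes_base_diagonal_def)
    then show False using diag_point_eq_iff[of "{}" A t 0] A t zero_noncentral False by auto
  qed
  have "{} \<noteq> B" "{} \<noteq> coords - B"
    using off_diagonal[of u] off_diagonal[of "opp u"] B diag_point_compl[of "opp u" B] by auto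
  moreover have "collinear (corner {}) (diag_point B u)"
    using collinear_line_auts_iff[OF g(1) corner_in_points corner_in_points, of "{}" A]
      collinear_diag_points[of 0 0 "{}" A] g(2) zero_noncentral image
    by (simp add: fixes_base_diagonal_def)
  ultimately have "u = 0 \<or> u = opp 0"
    using collinear_diag_points_imp_same_level[of "{}" B 0 u] B zero_noncentral by auto
  then have "g (corner A) = corner B \<or> g (corner A) = corner (coords - B)"
    using image diag_point_compl[of 0 B] zero_noncentral by auto
  then show ?thesis using B(1) by blast
qed

lemma corner_map_order_iff:
  assumes g: "g \<in> line_auts"
    and \<phi>: "\<And>A. A \<subseteq> coords \<Longrightarrow> \<phi> A \<subseteq> coords" "\<And>A. A \<subseteq> coords \<Longrightarrow> g (corner A) = corner (\<phi> A)"
    and empty: "\<phi> {} = {}" and AB: "A \<subseteq> coords" "B \<subseteq> coords"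
  shows "\<phi> B \<subseteq> \<phi> A \<longleftrightarrow> B \<subseteq> A"
proof -
  have eq_iff: "\<phi> D = \<phi> E \<longleftrightarrow> D = E" if "D \<subseteq> coords" "E \<subseteq> coords" for D E
    using that \<phi> corner_eq_iff line_auts_eq_iff[OF g corner_in_points corner_in_points] by metis
  have comparable_iff:
    "comparable (sym_diff (\<phi> D) (\<phi> E)) (sym_diff (\<phi> D) (\<phi> F)) \<longleftrightarrow>
      comparable (sym_diff D E) (sym_diff D F)"
    if DEF: "D \<subseteq> coords" "E \<subseteq> coords" "F \<subseteq> coords" "D \<noteq> E" "D \<noteq> F" for D E F
  proof -
    have "inner_transversal (corner (\<phi> D)) (corner (\<phi> E)) (corner (\<phi> F)) \<longleftrightarrow>
        inner_transversal (corner D) (corner E) (corner F)"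
      using inner_transversal_line_auts_iff[OF g, of "corner D" "corner E" "corner F"]
        corner_in_points \<phi>(2) DEF by simp
    then show ?thesis using inner_transversal_corners_iff \<phi>(1) DEF eq_iff by simp
  qed
  consider (A_empty) "A = {}" | (B_empty) "B = {}" | (equal) "A = B"
    | (generic) "A \<noteq> {}" "B \<noteq> {}" "A \<noteq> B" by blast
  then show ?thesis
  proof cases
    case A_empty
    then show ?thesis using empty eq_iff[of B "{}"] AB by auto
  next
    case generic
    then have "\<phi> A \<noteq> {}" using empty eq_iff[of A "{}"] AB by auto
    then show ?thesis
      using subset_iff_comparable_sym_diffs[OF generic(1), of B]
        subset_iff_comparable_sym_diffs[of "\<phi> A" "\<phi> B"]
        comparable_iff[of "{}" B A] comparable_iff[of A "{}" B] generic AB empty by simp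
  qed (simp_all add: empty)
qed

lemma corner_permutation_line_auts:
  assumes g: "g \<in> line_auts" "fixes_base_diagonal g"
  obtains s where "s permutes coords" "\<And>A. A \<subseteq> coords \<Longrightarrow> g (corner A) = corner (s -` A)"
proof -
  obtain \<phi> where \<phi>: "\<phi> A \<subseteq> coords" "g (corner A) = corner (\<phi> A)" if "A \<subseteq> coords" for A
    using corner_line_auts[OF g] by metis
  have empty: "\<phi> {} = {}"
    using \<phi>[of "{}"] g(2) zero_noncentral corner_eq_iff[of "\<phi> {}" "{}"]
    by (auto simp: fixes_base_diagonal_def)
  note order_iff = corner_map_order_iff[OF g(1) \<phi> empty]
  have "inj_on \<phi> (Pow coords)"
    by (rule inj_onI) (use order_iff in \<open>metis Pow_iff subset_antisym order_refl\<close>)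
  moreover from this have "\<phi> ` Pow coords = Pow coords"
    by (intro endo_inj_surj) (use \<phi>(1) in auto)
  ultimately have "bij_betw \<phi> (Pow coords) (Pow coords)" by (simp add: bij_betw_def)
  then obtain \<sigma> where \<sigma>: "\<sigma> permutes coords" "\<And>A. A \<subseteq> coords \<Longrightarrow> \<phi> A = \<sigma> ` A"
    using Pow_automorphism_induced_by_permutation[of \<phi> coords] order_iff by blast
  have "\<sigma> ` A = inv_into UNIV \<sigma> -` A" for A
    using bij_vimage_eq_inv_image[OF bij_imp_bij_inv] permutes_bij[OF \<sigma>(1)]
      permutes_inv_inv[OF \<sigma>(1)] by metis
  then show thesis using that[OF permutes_inv[OF \<sigma>(1)]] \<phi>(2) \<sigma>(2) by simp
qed

section \<open>Rigidity\<close>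

definition fixes_frame :: "((nat \<Rightarrow> nat) \<Rightarrow> nat \<Rightarrow> nat) \<Rightarrow> bool" where
  "fixes_frame g \<longleftrightarrow> fixes_base_diagonal g \<and> (\<forall>A\<subseteq>coords. g (corner A) = corner A)"

lemma line_auts_pencil_line:
  assumes f: "f \<in> line_auts" and t: "t < n" "t \<noteq> opp t" "t' < n"
    and S: "A \<subseteq> coords" "S \<subseteq> coords" "S \<noteq> {}" "S' \<subseteq> coords" "S' \<noteq> {}"
    and image: "f (diag_point A t) = diag_point A' t'"
      "f (diag_point (sym_diff A S) t) = diag_point (sym_diff A' S') t'"
  shows "f ` pencil_line A t S = pencil_line A' t' S'"
proof (rule line_unique)
  show "line (f ` pencil_line A t S)" using line_auts_line[OF f line_pencil_line] S t by simp
  show "line (pencil_line A' t' S')" using line_pencil_line S t by simp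
  show "diag_point A' t' \<in> f ` pencil_line A t S"
    "diag_point (sym_diff A' S') t' \<in> f ` pencil_line A t S"
    using diag_points_in_pencil_line[OF S(2) t(1), of A] unfolding image[symmetric] by blast+
  show "diag_point A' t' \<in> pencil_line A' t' S'"
    "diag_point (sym_diff A' S') t' \<in> pencil_line A' t' S'"
    using diag_points_in_pencil_line[OF S(4) t(3), of A'] by auto
  have "A \<noteq> sym_diff A S" "sym_diff A S \<subseteq> coords" using S by auto
  then have "diag_point A t \<noteq> diag_point (sym_diff A S) t"
    using diag_point_eq_iff[OF S(1) _ t(1) t(1,2)] t(2) by blast
  then show "diag_point A' t' \<noteq> diag_point (sym_diff A' S') t'"
    unfolding image[symmetric] using line_auts_eq_iff[OF f] t(1) by simp
qed

lemma fixes_frame_diag_point_levels: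
  assumes g: "g \<in> line_auts" "fixes_frame g" and A: "A \<subseteq> coords" "A \<noteq> {}" "A \<noteq> coords"
    and t: "t < n" "t \<noteq> opp t"
  shows "g (diag_point A t) = diag_point A t \<or> g (diag_point A t) = diag_point A (opp t)"
proof -
  have "diag_point A (opp 0) = corner (coords - A)"
    using diag_point_compl[of 0 A] zero_noncentral by simp
  then have ends: "g (corner A) = corner A" "g (diag_point A (opp 0)) = diag_point A (opp 0)"
    using g(2) A(1) by (auto simp: fixes_frame_def fixes_base_diagonal_def)
  have "g ` main_diagonal A = main_diagonal A"
  proof (rule line_unique)
    show "corner A \<in> main_diagonal A" "diag_point A (opp 0) \<in> main_diagonal A"
      using zero_noncentral by (auto simp: main_diagonal_def)
    then show "corner A \<in> g ` main_diagonal A" "diag_point A (opp 0) \<in> g ` main_diagonal A"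
      using ends by (metis imageI)+
    show "corner A \<noteq> diag_point A (opp 0)"
      using diag_point_inject[of 0 "opp 0" A] zero_noncentral by simp
  qed (use line_main_diagonal line_auts_line[OF g(1)] in auto)
  then obtain u where u: "u < n" "g (diag_point A t) = diag_point A u"
    using t(1) unfolding main_diagonal_def by blast
  have "u \<noteq> opp u"
    using noncentral_line_auts_iff[OF g(1), of "diag_point A t"] diag_point_noncentral_iff u t
    by simp
  moreover have "collinear (diag_point {} t) (diag_point A u)"
    using collinear_line_auts_iff[OF g(1), of "diag_point {} t" "diag_point A t"]
      collinear_diag_points[of t t "{}" A] g(2) u t(1)
    by (simp add: fixes_frame_def fixes_base_diagonal_def)
  ultimately have "u = t \<or> u = opp t"
    using collinear_diag_points_imp_same_level[of "{}" A t u] A t u by auto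
  then show ?thesis using u by auto
qed

lemma fixes_frame_diag_point_not_swapped:
  assumes g: "g \<in> line_auts" "fixes_frame g" and A: "A \<subseteq> coords" "A \<noteq> {}" "A \<noteq> coords"
    and t: "t < n" "t \<noteq> opp t" "t \<noteq> 0"
  shows "g (diag_point A t) \<noteq> diag_point A (opp t)"
proof
  assume swapped: "g (diag_point A t) = diag_point A (opp t)"
  obtain i where i: "i \<in> A" "i \<in> coords" using A by blast
  have complement: "coords - A \<subseteq> coords" "coords - A \<noteq> {}" using A by auto
  define X where "X = pencil_point {} t A 0"
  have "X = pencil_point {} 0 (coords - A) t"
    unfolding X_def by (rule points_eqI)
      (use A t zero_noncentral in \<open>auto simp: pencil_point_apply reflect_def line_point_in_points\<close>)
  then have "X \<in> pencil_line {} 0 (coords - A)" using line_point_in_param_line[OF t(1)] by simp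
  moreover have "g ` pencil_line {} 0 (coords - A) = pencil_line {} 0 (coords - A)"
    by (rule line_auts_pencil_line[OF g(1)])
       (use g(2) complement zero_noncentral in \<open>auto simp: fixes_frame_def fixes_base_diagonal_def\<close>)
  ultimately obtain s where "g X = pencil_point {} 0 (coords - A) s"
    unfolding param_line_def by blast
  then have "g X i = 0" using i by (simp add: pencil_point_apply reflect_def del: atLeastAtMost_iff)
  have "g ` pencil_line {} t A = pencil_line {} t (coords - A)"
    by (rule line_auts_pencil_line[OF g(1)])
       (use g(2) A complement t swapped diag_point_compl in
         \<open>auto simp: fixes_frame_def fixes_base_diagonal_def\<close>)
  moreover have "X \<in> pencil_line {} t A"
    unfolding X_def using line_point_in_param_line zero_noncentral by blast
  ultimately obtain s where "g X = pencil_point {} t (coords - A) s"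
    unfolding param_line_def by blast
  then have "g X i = t" using i by (simp add: pencil_point_apply reflect_def del: atLeastAtMost_iff)
  then show False using \<open>g X i = 0\<close> t(3) by simp
qed

lemma fixes_frame_diagonal_points:
  assumes g: "g \<in> line_auts" "fixes_frame g" and x: "x \<in> diagonal_points"
  shows "g x = x"
proof -
  obtain A t where x_eq: "x = diag_point A t" and A: "A \<subseteq> coords" and t: "t < n"
    using x by (auto simp: diagonal_points_def)
  consider (central) "t = opp t" | (base) "A = {}" | (reversed_base) "A = coords" | (corner) "t = 0"
    | (generic) "t \<noteq> opp t" "A \<noteq> {}" "A \<noteq> coords" "t \<noteq> 0" by blast
  then show ?thesis
  proof cases
    case central
    then have "reflect A i t = reflect {} i t" for i unfolding reflect_def by metis
    then have "x = diag_point {} t" by (simp add: x_eq diag_point_def)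
    then show ?thesis using g(2) t by (simp add: fixes_frame_def fixes_base_diagonal_def)
  next
    case reversed_base
    then have "x = diag_point {} (opp t)" using diag_point_compl[OF t, of "{}"] by (simp add: x_eq)
    then show ?thesis using g(2) by (simp add: fixes_frame_def fixes_base_diagonal_def)
  next
    case generic
    then show ?thesis
      using fixes_frame_diag_point_levels[OF g A _ _ t]
        fixes_frame_diag_point_not_swapped[OF g A _ _ t]
      by (auto simp: x_eq)
  qed (use g(2) A t x_eq in \<open>auto simp: fixes_frame_def fixes_base_diagonal_def\<close>)
qed

lemma fixes_frame_imp_id:
  assumes g: "g \<in> line_auts" "fixes_frame g" and "x \<in> points"
  shows "g x = x"
  using \<open>x \<in> points\<close>
proof (induction "card (levels x)" arbitrary: x rule: less_induct)
  case less
  note x = less.prems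
  show ?case
  proof (cases "x \<in> diagonal_points")
    case True
    then show ?thesis by (rule fixes_frame_diagonal_points[OF g])
  next
    case False
    then obtain k l where kl: "k \<in> coords" "l \<in> coords" "x k \<noteq> x l" "x k \<noteq> opp (x l)"
      using x diagonal_points_iff by blast
    have bound: "x k < n" "x l < n" using points_less[OF x] kl by auto
    have "level (x k) \<noteq> level (x l)" using level_eq_iff[OF bound] kl by blast
    moreover have "x k \<noteq> opp (x k) \<or> x l \<noteq> opp (x l)" using central_unique[OF bound] kl(3) by blast
    ultimately obtain i j where ij: "i \<in> coords" "j \<in> coords" "level (x i) \<noteq> level (x j)"
      "x i \<noteq> opp (x i)"
      using kl(1,2) by metis
    have in_range: "x i < n" "x j < n" using points_less[OF x] ij by auto
    have opp_level: "level (opp (x i)) = level (x i)"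
      using level_eq_iff[of "opp (x i)" "x i"] in_range by simp
    have fixed: "g (shift_level x j v) = shift_level x j v" if "v < n" "level v = level (x i)" for v
      using less.hyps card_levels_shift_level_less[OF ij(1-3) that]
        shift_level_in_points[OF x that(1)] by blast
    have "g (shift_level x i (x j)) = shift_level x i (x j)"
      using less.hyps card_levels_shift_level_less[OF ij(2,1) ij(3)[symmetric] in_range(2)]
        shift_level_in_points[OF x in_range(2)] by blast
    then show ?thesis
      using fixed_if_shift_levels_fixed[OF g(1) x ij] fixed in_range opp_level by simp
  qed
qed

section \<open>The group of line-preserving bijections\<close>

lemma line_auts_fixing_base_diagonalE:
  assumes g: "g \<in> line_auts" "fixes_base_diagonal g"
  obtains s where "s permutes coords" "g = cube_map s {} id"
proof -
  obtain s where s: "s permutes coords"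
    and g_corner: "\<And>A. A \<subseteq> coords \<Longrightarrow> g (corner A) = corner (s -` A)"
    using corner_permutation_line_auts[OF g] by blast
  define c where "c = cube_map s {} id"
  have c: "c \<in> line_auts" unfolding c_def by (rule cube_map_in_line_auts[OF s id_in_sym_perms])
  have c_diag: "c (diag_point A t) = diag_point (s -` A) t" if "t < n" for A t
    using cube_map_diag_point[OF s id_in_sym_perms that, of "{}" A] by (simp add: c_def)
  obtain h where h: "h \<in> line_auts" "g = compose points c h" using line_auts_factor[OF c g(1)] .
  have h_fixes: "h x = x" if "x \<in> points" "g x = c x" for x
    using that line_auts_eq_iff[OF c] line_auts_in_points[OF h(1)] by (simp add: h(2) compose_eq)
  have "fixes_frame h"
    unfolding fixes_frame_def fixes_base_diagonal_def
    using h_fixes c_diag g(2) g_corner zero_noncentral(1) by (simp add: fixes_base_diagonal_def)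
  then have "g = c"
    using fixes_frame_imp_id[OF h(1)] line_auts_extensional[OF g(1)] line_auts_extensional[OF c]
    by (intro extensionalityI[of g points c]) (auto simp: h(2) compose_eq)
  then show thesis using that s c_def by blast
qed

theorem line_auts_cube_mapE:
  assumes f: "f \<in> line_auts"
  obtains s B p where "s permutes coords" "B \<subseteq> coords" "p \<in> sym_perms n" "f = cube_map s B p"
proof -
  obtain B p where B: "B \<subseteq> coords" and p: "p \<in> sym_perms n"
    and f_diag: "\<And>t. t < n \<Longrightarrow> f (diag_point {} t) = diag_point B (p t)"
    using diag_point_line_auts[OF f, of "{}"] by blast
  define e where "e = cube_map id B p"
  have e: "e \<in> line_auts" unfolding e_def by (rule cube_map_in_line_auts[OF permutes_id p])
  obtain g where g: "g \<in> line_auts" "f = compose points e g" using line_auts_factor[OF e f] .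
  have g_diag: "fixes_base_diagonal g"
    unfolding fixes_base_diagonal_def
  proof (intro allI impI)
    fix t assume t: "t < n"
    have "e (g (diag_point {} t)) = e (diag_point {} t)"
      using f_diag[OF t] cube_map_diag_point[OF permutes_id p t, of B "{}"] t
      by (simp add: g(2) compose_eq flip: e_def)
    then show "g (diag_point {} t) = diag_point {} t"
      using line_auts_eq_iff[OF e] line_auts_in_points[OF g(1)] t by simp
  qed
  obtain s where s: "s permutes coords" "g = cube_map s {} id"
    using line_auts_fixing_base_diagonalE[OF g(1) g_diag] .
  then have "f = cube_map s B p"
    using compose_cube_map[OF permutes_id s(1) p id_in_sym_perms, of B "{}"]
    by (simp add: g(2) e_def)
  then show thesis using that s(1) B p by blast
qed

theorem bij_betw_cube_map:
  "bij_betw (\<lambda>(s, B, p). cube_map s B p)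
    ({s. s permutes coords} \<times> Pow (coords - {1}) \<times> sym_perms n) line_auts" (is "bij_betw ?f ?D _")
proof (rule bij_betw_imageI)
  show "inj_on ?f ?D"
  proof (rule inj_onI)
    fix z w assume zw: "z \<in> ?D" "w \<in> ?D" "?f z = ?f w"
    obtain s B p s' B' p' where z: "z = (s, B, p)" "w = (s', B', p')" by (metis prod_cases3)
    have s: "s permutes coords" "s' permutes coords" and p: "p \<in> sym_perms n" "p' \<in> sym_perms n"
      and eq: "cube_map s B p = cube_map s' B' p'"
      and B: "B \<subseteq> coords" "B' \<subseteq> coords" "1 \<notin> B" "1 \<notin> B'"
      using zw z by auto
    have "p = p'"
      using cube_map_eq_imp_value_permutation_eq[OF s p eq one_two_in_coords(1)] B(3,4) by simp
    then show "z = w"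
      using cube_map_eq_imp_reflections_eq[OF s p(1) B(1,2)]
        cube_map_eq_imp_permutation_eq[OF s p(1) eq] eq
      by (simp add: z)
  qed
  show "?f ` ?D = line_auts"
  proof (intro equalityI subsetI)
    fix f assume "f \<in> line_auts"
    then obtain s B p where f: "s permutes coords" "B \<subseteq> coords" "p \<in> sym_perms n"
      "f = cube_map s B p"
      by (rule line_auts_cube_mapE)
    show "f \<in> ?f ` ?D"
    proof (cases "1 \<in> B")
      case True
      have "f = ?f (s, coords - B, restrict_id opp {..<n} \<circ> p)" using f cube_map_compl by simp
      moreover have "(s, coords - B, restrict_id opp {..<n} \<circ> p) \<in> ?D"
        using f(1) True sym_perms_comp[OF opp_in_sym_perms f(3)] by auto
      ultimately show ?thesis by (rule image_eqI)
    next
      case False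
      then have "f = ?f (s, B, p)" "(s, B, p) \<in> ?D" using f by auto
      then show ?thesis by (rule image_eqI)
    qed
  qed (use cube_map_in_line_auts in auto)
qed

theorem order_line_group: "order (line_group n d) = fact d * 2 ^ (d - 1) * card (sym_perms n)"
proof -
  have "card (coords - {1}) = d - 1" using one_two_in_coords(1) by (simp add: card_Diff_singleton)
  then show ?thesis
    using bij_betw_same_card[OF bij_betw_cube_map]
    by (simp add: order_def card_cartesian_product card_permutations card_Pow)
qed

end

theorem theorem7:
  fixes n d :: nat
  assumes "n \<ge> 3" and "d \<ge> 2"
  shows "order (line_group n d) = order (rot_group n d) * order (coord_group n d)"
proof -
  interpret tictactoe_cube n d using assms by unfold_locales auto
  have "order (line_group n d) = fact d * 2 ^ (d - 1) * card (sym_perms n)"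
    by (rule order_line_group)
  also have "fact d * 2 ^ (d - 1) = order (rot_group n d)"
    using assms(2) by (intro order_rot_group[symmetric]) simp
  also have "card (sym_perms n) = order (coord_group n d)"
    using assms(2) by (intro order_coord_group[symmetric]) simp
  finally show ?thesis .
qed

end
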